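(* Let $\Phi=\{f_i(x)=\lambda_i x+t_i\}_{i=1}^N$ be a self-similar IFS on $\mathbb{R}$ (with $\lambda_i\in(0,1)$, $t_i\in\mathbb{R}$) whose similarity dimension $s$, i.e. the solution of $\sum_{i=1}^N\lambda_i^s=1$, satisfies $s>1$. Let $\mu$ be a Borel measure on $\Omega=\{1,\dots,N\}^{\mathbb{N}}$ for which there exist $K>0$ and $s'>1$ such that $$\mu([\omega])\le K\lambda_\omega^{s'}\quad\text{for every finite word }\omega\in\Omega^*.$$ Let $\Theta$ be a bounded real random variable with compactly supported absolutely continuous distribution, such that for some $C>0$ and some $M\ge s'$ the Fourier transform of its distribution satisfies $$|\widehat{\Theta}(x)|\le \frac{C}{(1+|x|)^M}\quad\text{for all }x\in\mathbb{R}.$$ Then, for $\mathbb{P}$-almost every $\underline{\Theta}$, the measure $\nu_{\underline{\Theta}}=(\Pi_{\underline{\Theta}})_*\mu$ is absolutely continuous with respect to the Lebesgue measure on the line and has a Hölder continuous density.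
   Context: $\Omega=\{1,\dots,N\}^{\mathbb{N}}$, whose elements are written $\omega=(\omega_0,\omega_1,\omega_2,\dots)$, carries the product topology; $\Omega^*=\bigcup_{n\ge0}\{1,\dots,N\}^n$ is the set of finite words (including the empty word $\emptyset$). For $\omega\in\Omega$ and $j\ge 0$, $\omega^j=(\omega_0,\dots,\omega_{j-1})$ is the prefix of length $j$ ($\omega^0=\emptyset$). For a finite word $\omega=(\omega_0,\dots,\omega_{j-1})$, $\lambda_\omega=\prod_{i=0}^{j-1}\lambda_{\omega_i}$ (with $\lambda_\emptyset=1$), and $[\omega]\subset\Omega$ is the cylinder set of all infinite sequences having $\omega$ as prefix. Random perturbation: $\{\Theta_\omega\}_{\omega\in\Omega^*}$ are independent copies of $\Theta$, $\underline{\Theta}=(\Theta_\omega)_{\omega\in\Omega^*}$ denotes the whole collection, and $\mathbb{P}$ is its (product) distribution. The random projection is $$\Pi_{\underline{\Theta}}(\omega)=\sum_{j=0}^\infty\lambda_{\omega^j}\,(t_{\omega_j}+\Theta_{\omega^j}),\qquad \omega\in\Omega.$$ The Fourier transform of the distribution of $\Theta$ is $\widehat{\Theta}(x)=\mathbb{E}(e^{ix\Theta})$. *)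

theory Defs
  imports "HOL-Probability.Probability"
begin

definition word_ratio :: "(nat \<Rightarrow> real) \<Rightarrow> nat list \<Rightarrow> real" where
  "word_ratio lam w = prod_list (map lam w)"

definition prefix_word :: "nat \<Rightarrow> (nat \<Rightarrow> nat) \<Rightarrow> nat list" where
  "prefix_word j \<omega> = map \<omega> [0..<j]"

definition seq_topology :: "nat \<Rightarrow> (nat \<Rightarrow> nat) topology" where
  "seq_topology N = product_topology (\<lambda>_. discrete_topology {1..N}) UNIV"

definition seq_borel :: "nat \<Rightarrow> (nat \<Rightarrow> nat) measure" where
  "seq_borel N = sigma (topspace (seq_topology N)) {U. openin (seq_topology N) U}"

definition cylinder :: "nat \<Rightarrow> nat list \<Rightarrow> (nat \<Rightarrow> nat) set" where
  "cylinder N w = {\<omega> \<in> topspace (seq_topology N). prefix_word (length w) \<omega> = w}"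

text \<open>The product law of independent copies of a random variable with law \<open>D\<close>,
  one for each finite word over the alphabet \<open>{1..N}\<close> (the empty word included).\<close>

definition perturbation_law :: "nat \<Rightarrow> real measure \<Rightarrow> (nat list \<Rightarrow> real) measure" where
  "perturbation_law N D = PiM (lists {1..N}) (\<lambda>_. D)"

text \<open>For ratios in \<open>(0,1)\<close> the series converges whenever \<open>\<theta>\<close> is bounded on the words;
  for the other \<open>\<theta>\<close> the value may be meaningless.\<close>

definition random_projection ::
  "(nat \<Rightarrow> real) \<Rightarrow> (nat \<Rightarrow> real) \<Rightarrow> (nat list \<Rightarrow> real) \<Rightarrow> (nat \<Rightarrow> nat) \<Rightarrow> real" where
  "random_projection lam t \<theta> \<omega> =
     (\<Sum>j. word_ratio lam (prefix_word j \<omega>) * (t (\<omega> j) + \<theta> (prefix_word j \<omega>)))"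

definition measure_support :: "'a::topological_space measure \<Rightarrow> 'a set" where
  "measure_support D = {x. \<forall>U. open U \<longrightarrow> x \<in> U \<longrightarrow> emeasure D U > 0}"

definition holder_continuous :: "('a::metric_space \<Rightarrow> 'b::metric_space) \<Rightarrow> bool" where
  "holder_continuous f \<longleftrightarrow>
     (\<exists>\<alpha> C. 0 < \<alpha> \<and> \<alpha> \<le> 1 \<and> (\<forall>x y. dist (f x) (f y) \<le> C * dist x y powr \<alpha>))"

end

theory Submission
  imports Defs "HOL-Real_Asymp.Real_Asymp"
begin

text \<open>
  The density of \<open>\<nu>\<^bsub>\<theta>\<^esub>\<close> is the limit of a martingale of random densities. Let \<open>f\<^sub>n\<close> be the density
  of the conditional expectation of \<open>\<nu>\<^bsub>\<theta>\<^esub>\<close> given the perturbations at the words shorter than \<open>n\<close>. It is a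
  sum, over the words \<open>w\<close> of length \<open>n\<close>, of translates of a deterministic function: the density of the
  part of \<open>\<nu>\<^bsub>\<theta>\<^esub>\<close> carried by the cylinder of \<open>w\<close>, averaged over all perturbations at \<open>w\<close> and its
  descendants.

  Such a piece contains a convolution with the law of \<open>\<lambda>\<^sub>w \<Theta>\<^sub>w\<close>. Since the Fourier decay exponent exceeds
  1, \<open>\<Theta>\<close> has a bounded Hoelder density (\<open>holder_density_of_char_decay\<close>), so the piece is at most a
  constant times \<open>\<mu>[w] / \<lambda>\<^sub>w\<close>, hence at most a constant times \<open>\<lambda>\<^sub>w\<close> to the power \<open>s' - 1\<close>. Here \<open>s' > 1\<close>
  enters: every piece is exponentially small in \<open>n\<close>.

  Given the first \<open>n\<close> levels, \<open>f\<^bsub>n+1\<^esub> x - f\<^sub>n x\<close> is a sum of independent centred terms, each of size at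
  most \<open>K \<rho> ^ (2 * n)\<close> with \<open>\<rho> < 1\<close>. Because the pieces are nonnegative, the sum of their conditional
  variances is at most \<open>K \<rho> ^ (2 * n) * f\<^sub>n x\<close>. A Bernstein type estimate
  (\<open>nn_integral_increment_le_one\<close>) says that the increment exceeds \<open>K \<rho> ^ n * (f\<^sub>n x + u)\<close> only with
  probability at most \<open>2 exp (-u)\<close>. Taking \<open>u\<close> proportional to \<open>n\<close>, this remains summable after a union
  bound over a grid with exponentially many points, so by the Borel-Cantelli lemma almost surely the
  increment is at most \<open>A \<rho> ^ n * (f\<^sub>n x + n + 1)\<close> on all fine enough grids (\<open>AE_increment_on_grid\<close>).

  The rest of the convergence is deterministic (\<open>holder_limit_of_grid_control\<close>). Each \<open>f\<^sub>n\<close> is Hoelder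
  with a constant growing at most exponentially in \<open>n\<close>, so a grid of exponentially small mesh controls
  the increment everywhere. The resulting recursive inequality first bounds the \<open>f\<^sub>n\<close> uniformly, and
  then gives uniform convergence at a geometric rate; interpolating between that rate and the
  exponentially growing Hoelder constants makes the limit \<open>g\<close> Hoelder continuous.

  Finally, \<open>f\<^sub>n\<close> is also the density of a random point obtained from \<open>\<Pi>\<^bsub>\<theta>\<^esub> \<omega>\<close> by resampling the
  perturbations from level \<open>n\<close> on, which displaces it by at most an exponentially small amount. Comparing
  distribution functions identifies \<open>g\<close> as the density of \<open>\<nu>\<^bsub>\<theta>\<^esub>\<close> (\<open>distr_eq_density_limit\<close>).
\<close>

section \<open>Hoelder continuous limits of functions controlled on grids\<close>

lemma continuous_on_of_holder_bound:
  fixes f :: "real \<Rightarrow> 'a::real_normed_vector"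
  assumes "0 < \<gamma>" and "\<And>x y. norm (f x - f y) \<le> L * \<bar>x - y\<bar> powr \<gamma>"
  shows "continuous_on A f"
proof (rule continuous_at_imp_continuous_on, intro ballI)
  fix x
  have "((\<lambda>y. L * \<bar>y - x\<bar> powr \<gamma>) \<longlongrightarrow> 0) (at x)"
    using \<open>0 < \<gamma>\<close> by (auto intro!: tendsto_eq_intros)
  then have "((\<lambda>y. f y - f x) \<longlongrightarrow> 0) (at x)"
    by (rule Lim_null_comparison[rotated]) (use assms(2) in auto)
  then show "isCont f x" by (simp add: isCont_def LIM_zero_iff)
qed

lemma borel_measurable_holder_continuous:
  fixes g :: "real \<Rightarrow> real"
  assumes "holder_continuous g"
  shows "g \<in> borel_measurable borel"
proof -
  obtain \<alpha> C where "0 < \<alpha>" "\<And>x y. norm (g x - g y) \<le> C * \<bar>x - y\<bar> powr \<alpha>"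
    using assms by (auto simp: holder_continuous_def dist_real_def)
  then show ?thesis
    by (intro borel_measurable_continuous_onI continuous_on_of_holder_bound)
qed

text \<open>
  A function that is approximated to within \<open>\<sigma> ^ n\<close> by functions with Hoelder constant \<open>\<Lambda> ^ n\<close> satisfies
  a bound of the assumed kind for every large \<open>n\<close>. Choosing \<open>n\<close> according to the distance
  of the two points turns these bounds into a single Hoelder bound with a smaller exponent.
\<close>

lemma holder_continuous_interpolation:
  fixes g :: "real \<Rightarrow> real" and \<sigma> \<Lambda> \<gamma> A U :: real
  assumes "0 < \<sigma>" "\<sigma> < 1" "1 \<le> \<Lambda>" "0 < \<gamma>" "\<gamma> \<le> 1" "0 \<le> A"
    and osc: "\<And>x y. \<bar>g x - g y\<bar> \<le> U"
    and interp: "\<And>n x y. nmin \<le> n \<Longrightarrow> \<bar>g x - g y\<bar> \<le> A * (\<sigma> ^ n + \<Lambda> ^ n * \<bar>x - y\<bar> powr \<gamma>)"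
  shows "holder_continuous g"
proof -
  \<comment> \<open>At distance \<open>p ^ n\<close> the two terms of the bound balance, and both equal \<open>(p ^ n) powr \<alpha>\<close>.\<close>
  define p where "p = (\<sigma> / \<Lambda>) powr (1 / \<gamma>)"
  define \<alpha> where "\<alpha> = ln \<sigma> / ln p"
  have quot: "0 < \<sigma> / \<Lambda>" "\<sigma> / \<Lambda> \<le> \<sigma>"
    using assms by (auto simp: field_simps)
  have p_le: "p \<le> \<sigma>"
  proof -
    have "p \<le> (\<sigma> / \<Lambda>) powr 1"
      unfolding p_def by (rule powr_mono') (use quot assms in \<open>auto simp: field_simps\<close>)
    then show ?thesis using quot by simp
  qed
  have p: "0 < p" "p < 1"
    using quot p_le assms by (auto simp: p_def)
  have p_\<gamma>: "p powr \<gamma> = \<sigma> / \<Lambda>"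
    using quot assms by (simp add: p_def powr_powr)
  have ln_neg: "ln p < 0" "ln \<sigma> < 0" "ln p \<le> ln \<sigma>"
    using p assms p_le by auto
  have \<alpha>: "0 < \<alpha>" "\<alpha> \<le> 1"
    using ln_neg by (auto simp: \<alpha>_def field_simps)
  have p_\<alpha>: "p powr \<alpha> = \<sigma>"
    using p assms ln_neg by (simp add: powr_def \<alpha>_def)
  have pow_powr: "(p ^ n) powr c = (p powr c) ^ n" for n c
    using p by (simp add: powr_power powr_realpow[symmetric] powr_powr mult.commute)
  have U: "0 \<le> U"
    using osc[of 0 0] by simp
  define D where "D = max (U / \<sigma> ^ nmin) (2 * A / \<sigma>)"
  have "\<bar>g x - g y\<bar> \<le> D * \<bar>x - y\<bar> powr \<alpha>" for x y
  proof (cases "x = y")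
    case False
    define d where "d = \<bar>x - y\<bar>"
    have "0 < d" using False by (simp add: d_def)
    show ?thesis
    proof (cases "p ^ nmin \<le> d")
      case True
      have "\<sigma> ^ nmin = (p ^ nmin) powr \<alpha>"
        by (simp add: pow_powr p_\<alpha>)
      also have "\<dots> \<le> d powr \<alpha>"
        using True p \<alpha> by (intro powr_mono2) auto
      finally have "U / \<sigma> ^ nmin * \<sigma> ^ nmin \<le> D * d powr \<alpha>"
        using U assms by (intro mult_mono) (auto simp: D_def intro: max.coboundedI1)
      then show ?thesis
        using osc[of x y] \<open>0 < \<sigma>\<close> unfolding d_def by (auto intro: order_trans)
    next
      case False
      obtain m0 where "p ^ m0 < d"
        using real_arch_pow_inv[OF \<open>0 < d\<close> p(2)] by blast
      define m where "m = (LEAST m. p ^ m < d)"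
      have m: "p ^ m < d"
        unfolding m_def by (rule LeastI) fact
      have "nmin < m"
      proof (rule ccontr)
        assume "\<not> nmin < m"
        then have "p ^ nmin \<le> p ^ m" using p by (intro power_decreasing) auto
        then show False using m False by simp
      qed
      then obtain n where n: "m = Suc n" "nmin \<le> n"
        by (cases m) auto
      have "\<not> p ^ n < d"
        using not_less_Least[of n "\<lambda>m. p ^ m < d"] n unfolding m_def by simp
      then have d_le: "d \<le> p ^ n" by simp
      have "\<sigma> ^ Suc n = (p ^ m) powr \<alpha>"
        by (simp only: pow_powr p_\<alpha> n)
      also have "\<dots> \<le> d powr \<alpha>"
        using m p \<alpha> by (intro powr_mono2) auto
      finally have \<sigma>_le: "\<sigma> ^ n \<le> d powr \<alpha> / \<sigma>"
        using assms by (simp add: field_simps)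
      have "\<Lambda> ^ n * d powr \<gamma> \<le> \<Lambda> ^ n * (p ^ n) powr \<gamma>"
        using d_le \<open>0 < d\<close> assms by (intro mult_left_mono powr_mono2) auto
      also have "\<dots> = \<sigma> ^ n"
        using assms by (simp add: pow_powr p_\<gamma> power_divide)
      finally have "\<bar>g x - g y\<bar> \<le> A * (\<sigma> ^ n + \<sigma> ^ n)"
        using interp[OF n(2), of x y] assms unfolding d_def
        by (smt (verit, best) mult_left_mono)
      also have "\<dots> \<le> A * (2 * (d powr \<alpha> / \<sigma>))"
        using \<sigma>_le assms by (intro mult_left_mono) auto
      also have "\<dots> = 2 * A / \<sigma> * d powr \<alpha>"
        by simp
      also have "\<dots> \<le> D * d powr \<alpha>"
        by (intro mult_right_mono) (auto simp: D_def)
      finally show ?thesis by (simp add: d_def)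
    qed
  qed simp
  then show ?thesis
    using \<alpha> unfolding holder_continuous_def dist_real_def by blast
qed

text \<open>
  The mesh \<open>\<delta> ^ n\<close> is so fine that \<open>f n\<close> varies by at most \<open>L * \<rho> ^ n\<close> between neighbouring grid points,
  so the control of the increments extends from the grid to the whole line. The bound on
  the increment involves \<open>f n\<close> itself, with a summable factor; a multiplicative Gronwall argument
  therefore bounds the sequence, after which the increments decay geometrically.
\<close>

lemma holder_limit_of_grid_control:
  fixes f :: "nat \<Rightarrow> real \<Rightarrow> real" and R L \<Lambda> \<gamma> \<rho> \<delta> A :: real
  assumes "0 \<le> R" "0 \<le> L" "1 \<le> \<Lambda>" "0 < \<gamma>" "\<gamma> \<le> 1" "0 < \<rho>" "\<rho> < 1" "0 < \<delta>" "\<delta> < 1" "0 \<le> A"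
    and mesh: "\<Lambda> * \<delta> powr \<gamma> \<le> \<rho>"
    and nonneg: "\<And>n x. 0 \<le> f n x"
    and supp: "\<And>n x. R < \<bar>x\<bar> \<Longrightarrow> f n x = 0"
    and holder: "\<And>n x y. \<bar>f n x - f n y\<bar> \<le> L * \<Lambda> ^ n * \<bar>x - y\<bar> powr \<gamma>"
    and grid: "\<forall>\<^sub>F n in sequentially. \<forall>k::nat. real k * \<delta> ^ n \<le> 2 * R \<longrightarrow>
        \<bar>f (Suc n) (-R + real k * \<delta> ^ n) - f n (-R + real k * \<delta> ^ n)\<bar>
          \<le> A * \<rho> ^ n * (f n (-R + real k * \<delta> ^ n) + real (Suc n))"
  obtains g n0 U where "\<And>x. (\<lambda>n. f n x) \<longlonglongrightarrow> g x" "\<And>x. 0 \<le> g x" "holder_continuous g"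
    "\<And>n x. n0 \<le> n \<Longrightarrow> f n x \<le> U"
proof -
  obtain n0 where n0: "\<And>n k. n0 \<le> n \<Longrightarrow> real k * \<delta> ^ n \<le> 2 * R \<Longrightarrow>
        \<bar>f (Suc n) (-R + real k * \<delta> ^ n) - f n (-R + real k * \<delta> ^ n)\<bar>
          \<le> A * \<rho> ^ n * (f n (-R + real k * \<delta> ^ n) + real (Suc n))"
    using grid unfolding eventually_sequentially by blast
  \<comment> \<open>From the grid to the line: compare with the nearest grid point \<open>x'\<close> on the left.\<close>
  define A1 where "A1 = A * (1 + L) + L * (1 + \<Lambda>)"
  have step1: "\<bar>f (Suc n) x - f n x\<bar> \<le> A1 * \<rho> ^ n * (f n x + real (Suc n))" if "n0 \<le> n" for n x
  proof (cases "\<bar>x\<bar> \<le> R")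
    case False
    then show ?thesis
      using supp[of x n] supp[of x "Suc n"] assms by (simp add: A1_def)
  next
    case True
    define k where "k = nat \<lfloor>(x + R) / \<delta> ^ n\<rfloor>"
    define x' where "x' = -R + real k * \<delta> ^ n"
    have qn: "0 < \<delta> ^ n" using assms by simp
    have "0 \<le> (x + R) / \<delta> ^ n" using True qn by simp
    then have "real k \<le> (x + R) / \<delta> ^ n" "(x + R) / \<delta> ^ n < real k + 1"
      unfolding k_def by (auto simp: of_nat_nat)
    then have k: "real k * \<delta> ^ n \<le> x + R" "x + R < real k * \<delta> ^ n + \<delta> ^ n"
      using qn by (auto simp: field_simps)
    then have x': "\<bar>x - x'\<bar> \<le> \<delta> ^ n" unfolding x'_def by auto
    have "\<bar>x - x'\<bar> powr \<gamma> \<le> (\<delta> ^ n) powr \<gamma>"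
      using x' assms by (intro powr_mono2) auto
    also have "(\<delta> ^ n) powr \<gamma> = (\<delta> powr \<gamma>) ^ n"
      using assms by (simp add: powr_power powr_realpow[symmetric] powr_powr mult.commute)
    finally have "\<Lambda> ^ n * \<bar>x - x'\<bar> powr \<gamma> \<le> \<Lambda> ^ n * (\<delta> powr \<gamma>) ^ n"
      using assms by (intro mult_left_mono) auto
    also have "\<dots> \<le> \<rho> ^ n"
      unfolding power_mult_distrib[symmetric] using mesh assms by (intro power_mono) auto
    finally have scale: "\<Lambda> ^ n * \<bar>x - x'\<bar> powr \<gamma> \<le> \<rho> ^ n" .
    have near: "\<bar>f n x - f n x'\<bar> \<le> L * \<rho> ^ n"
      using order_trans[OF holder[of n x x']] scale assms
      by (metis (no_types, lifting) mult.assoc mult_left_mono)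
    have "\<bar>f (Suc n) x - f (Suc n) x'\<bar> \<le> L * \<Lambda> * (\<Lambda> ^ n * \<bar>x - x'\<bar> powr \<gamma>)"
      using holder[of "Suc n" x x'] by (simp add: mult_ac)
    also have "\<dots> \<le> L * \<Lambda> * \<rho> ^ n"
      using assms scale by (intro mult_left_mono) auto
    finally have near': "\<bar>f (Suc n) x - f (Suc n) x'\<bar> \<le> L * \<Lambda> * \<rho> ^ n" .
    have at_grid: "\<bar>f (Suc n) x' - f n x'\<bar> \<le> A * \<rho> ^ n * (f n x' + real (Suc n))"
      unfolding x'_def using k True by (intro n0 that) auto
    have pn: "0 \<le> \<rho> ^ n" "\<rho> ^ n \<le> 1"
      using assms by (auto simp: power_le_one)
    have "f n x' \<le> f n x + L"
      using near pn assms mult_left_le[of "\<rho> ^ n" L] by linarith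
    then have "A * \<rho> ^ n * (f n x' + real (Suc n)) \<le> A * \<rho> ^ n * ((1 + L) * (f n x + real (Suc n)))"
    proof (intro mult_left_mono)
      have "L * 1 \<le> L * (f n x + real (Suc n))"
        using assms nonneg[of n x] by (intro mult_left_mono) auto
      then show "f n x' + real (Suc n) \<le> (1 + L) * (f n x + real (Suc n))"
        using \<open>f n x' \<le> f n x + L\<close> by (simp add: algebra_simps)
    qed (use assms in auto)
    moreover have "L * (1 + \<Lambda>) * \<rho> ^ n * 1 \<le> L * (1 + \<Lambda>) * \<rho> ^ n * (f n x + real (Suc n))"
      using assms nonneg[of n x] by (intro mult_left_mono) auto
    ultimately show ?thesis
      using near near' at_grid unfolding A1_def by (simp add: algebra_simps)
  qed
  have A1: "0 \<le> A1"
    using assms by (simp add: A1_def)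
  \<comment> \<open>Half of the exponential decay is spent on absorbing the factor \<open>Suc n\<close>.\<close>
  define \<sigma> where "\<sigma> = sqrt \<rho>"
  have \<sigma>: "0 < \<sigma>" "\<sigma> < 1" "\<sigma> * \<sigma> = \<rho>"
    using assms by (auto simp: \<sigma>_def)
  have "(\<lambda>n. real (Suc n) * \<sigma> ^ n) \<longlonglongrightarrow> 0"
    using \<sigma> by real_asymp
  then obtain T where T: "\<And>n. \<bar>real (Suc n) * \<sigma> ^ n\<bar> \<le> T"
    using convergentI Bseq_def convergent_imp_Bseq[of "\<lambda>n. real (Suc n) * \<sigma> ^ n"]
    by (auto simp: Bseq_def)
  define A2 where "A2 = A1 * T"
  have T0: "0 \<le> T" using T[of 0] by simp
  then have A2: "0 \<le> A2" using A1 by (simp add: A2_def)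
  have step2: "\<bar>f (Suc n) x - f n x\<bar> \<le> A2 * \<sigma> ^ n * (f n x + 1)" if "n0 \<le> n" for n x
  proof -
    have "f n x + real (Suc n) \<le> real (Suc n) * (f n x + 1)"
      using nonneg[of n x] by (simp add: algebra_simps)
    then have "A1 * \<rho> ^ n * (f n x + real (Suc n)) \<le> A1 * \<rho> ^ n * (real (Suc n) * (f n x + 1))"
      using A1 assms by (intro mult_left_mono) auto
    also have "\<dots> = A1 * \<sigma> ^ n * (f n x + 1) * (real (Suc n) * \<sigma> ^ n)"
      by (simp add: \<sigma>(3)[symmetric] power_mult_distrib mult_ac)
    also have "\<dots> \<le> A1 * \<sigma> ^ n * (f n x + 1) * T"
      using T[of n] A1 \<sigma> nonneg[of n x] by (intro mult_left_mono) auto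
    finally show ?thesis
      using step1[OF that, of x] by (simp add: A2_def mult_ac)
  qed
  \<comment> \<open>Adding 1 makes the recursive inequality purely multiplicative.\<close>
  have growth: "f (n0 + m) x + 1 \<le> (f n0 x + 1) * exp (A2 * (\<Sum>k<m. \<sigma> ^ (n0 + k)))" for m x
  proof (induction m)
    case (Suc m)
    have "f (n0 + Suc m) x + 1 \<le> (f (n0 + m) x + 1) * (1 + A2 * \<sigma> ^ (n0 + m))"
      using step2[of "n0 + m" x] by (simp add: algebra_simps)
    also have "\<dots> \<le> (f n0 x + 1) * exp (A2 * (\<Sum>k<m. \<sigma> ^ (n0 + k))) * exp (A2 * \<sigma> ^ (n0 + m))"
      using Suc A2 \<sigma> nonneg[of n0 x] by (intro mult_mono) auto
    finally show ?case by (simp add: exp_add algebra_simps)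
  qed simp
  have geom: "(\<Sum>k<m. \<sigma> ^ (n + k)) \<le> \<sigma> ^ n / (1 - \<sigma>)" for m n
  proof -
    have "(\<Sum>k<m. \<sigma> ^ (n + k)) = \<sigma> ^ n * (\<Sum>k<m. \<sigma> ^ k)"
      by (simp add: power_add sum_distrib_left)
    also have "(\<Sum>k<m. \<sigma> ^ k) \<le> (\<Sum>k. \<sigma> ^ k)"
      using \<sigma> by (intro sum_le_suminf) auto
    also have "\<dots> = 1 / (1 - \<sigma>)"
      using \<sigma> by (intro suminf_geometric) auto
    finally show ?thesis using \<sigma> by simp
  qed
  define U0 where "U0 = L * \<Lambda> ^ n0 * (2 * R + 1) powr \<gamma>"
  have f_n0: "f n0 x \<le> U0" for x
  proof (cases "\<bar>x\<bar> \<le> R")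
    case True
    have "f n0 x \<le> L * \<Lambda> ^ n0 * \<bar>x - (R + 1)\<bar> powr \<gamma>"
      using holder[of n0 x "R + 1"] supp[of "R + 1" n0] assms by simp
    also have "\<dots> \<le> U0"
      unfolding U0_def using True assms by (intro mult_left_mono powr_mono2) auto
    finally show ?thesis .
  qed (use supp[of x n0] assms in \<open>simp add: U0_def\<close>)
  define U where "U = (U0 + 1) * exp (A2 * (\<sigma> ^ n0 / (1 - \<sigma>)))"
  have bdd: "f n x + 1 \<le> U" if "n0 \<le> n" for n x
  proof -
    have "f n x + 1 \<le> (f n0 x + 1) * exp (A2 * (\<Sum>k<n - n0. \<sigma> ^ (n0 + k)))"
      using growth[of "n - n0" x] that by simp
    also have "\<dots> \<le> U"
      unfolding U_def using f_n0[of x] nonneg[of n0 x] geom[of n0] A2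
      by (intro mult_mono iffD2[OF exp_le_cancel_iff] mult_left_mono) auto
    finally show ?thesis .
  qed
  have U: "0 \<le> U"
    using bdd[of n0 0] nonneg[of n0 0] by simp
  have step3: "\<bar>f (Suc n) x - f n x\<bar> \<le> A2 * U * \<sigma> ^ n" if "n0 \<le> n" for n x
  proof -
    have "A2 * \<sigma> ^ n * (f n x + 1) \<le> A2 * \<sigma> ^ n * U"
      using bdd[OF that] A2 \<sigma> by (intro mult_left_mono) auto
    then show ?thesis using step2[OF that, of x] by (simp add: mult_ac)
  qed
  define A3 where "A3 = A2 * U / (1 - \<sigma>)"
  have A3: "0 \<le> A3" using A2 U \<sigma> by (simp add: A3_def)
  have tail: "\<bar>f (n + m) x - f n x\<bar> \<le> A3 * \<sigma> ^ n" if "n0 \<le> n" for n m x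
  proof -
    have "\<bar>f (n + m) x - f n x\<bar> \<le> A2 * U * (\<Sum>k<m. \<sigma> ^ (n + k))"
    proof (induction m)
      case (Suc m)
      then show ?case using step3[of "n + m" x] that by (simp add: algebra_simps)
    qed simp
    also have "\<dots> \<le> A2 * U * (\<sigma> ^ n / (1 - \<sigma>))"
      using geom[of n m] A2 U by (intro mult_left_mono) auto
    finally show ?thesis by (simp add: A3_def)
  qed
  have "convergent (\<lambda>n. f n x)" for x
  proof (rule Cauchy_convergent, rule metric_CauchyI)
    fix e :: real assume "0 < e"
    have "(\<lambda>n. 2 * A3 * \<sigma> ^ n) \<longlonglongrightarrow> 0"
      using \<sigma> by real_asymp
    from order_tendstoD(2)[OF this \<open>0 < e\<close>]
    have "eventually (\<lambda>n. 2 * A3 * \<sigma> ^ n < e \<and> n0 \<le> n) sequentially"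
      using eventually_ge_at_top[of n0] by eventually_elim auto
    then obtain n where n: "2 * A3 * \<sigma> ^ n < e" "n0 \<le> n"
      by (auto simp: eventually_sequentially)
    show "\<exists>M. \<forall>m\<ge>M. \<forall>k\<ge>M. dist (f m x) (f k x) < e"
    proof (intro exI allI impI)
      fix m k assume "n \<le> m" "n \<le> k"
      then show "dist (f m x) (f k x) < e"
        using tail[OF n(2), of "m - n" x] tail[OF n(2), of "k - n" x] n(1)
        by (simp add: dist_real_def)
    qed
  qed
  then obtain g where lim: "\<And>x. (\<lambda>n. f n x) \<longlonglongrightarrow> g x"
    unfolding convergent_def by metis
  have close: "\<bar>g x - f n x\<bar> \<le> A3 * \<sigma> ^ n" if "n0 \<le> n" for n x
  proof (rule LIMSEQ_le_const2)
    show "(\<lambda>m. \<bar>f m x - f n x\<bar>) \<longlonglongrightarrow> \<bar>g x - f n x\<bar>"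
      by (intro tendsto_intros lim)
    show "\<exists>N. \<forall>m\<ge>N. \<bar>f m x - f n x\<bar> \<le> A3 * \<sigma> ^ n"
      using tail[OF that, of _ x] by (metis le_add_diff_inverse)
  qed
  have g_nonneg: "0 \<le> g x" for x
    by (rule LIMSEQ_le_const[OF lim]) (use nonneg in auto)
  have g_le: "g x \<le> U" for x
    by (rule LIMSEQ_le_const2[OF lim]) (use bdd in \<open>auto intro!: exI[of _ n0] simp: algebra_simps\<close>, smt (verit) bdd)
  have "holder_continuous g"
  proof (rule holder_continuous_interpolation[where nmin = n0 and A = "2 * A3 + L"])
    show "\<bar>g x - g y\<bar> \<le> U" for x y
      using g_nonneg[of x] g_nonneg[of y] g_le[of x] g_le[of y] by linarith
    show "\<bar>g x - g y\<bar> \<le> (2 * A3 + L) * (\<sigma> ^ n + \<Lambda> ^ n * \<bar>x - y\<bar> powr \<gamma>)" if "n0 \<le> n" for n x y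
    proof -
      have "\<bar>g x - g y\<bar> \<le> 2 * A3 * \<sigma> ^ n + L * (\<Lambda> ^ n * \<bar>x - y\<bar> powr \<gamma>)"
        using close[OF that, of x] close[OF that, of y] holder[of n x y] by (simp add: algebra_simps)
      moreover have "0 \<le> 2 * A3 * (\<Lambda> ^ n * \<bar>x - y\<bar> powr \<gamma>)" "0 \<le> L * \<sigma> ^ n"
        using A3 \<sigma> assms by auto
      ultimately show ?thesis by (simp add: algebra_simps)
    qed
  qed (use \<sigma> assms A3 in auto)
  moreover have "f n x \<le> U" if "n0 \<le> n" for n x
    using bdd[OF that, of x] by simp
  ultimately show ?thesis
    using that lim g_nonneg by blast
qed

section \<open>Hoelder densities from Fourier decay\<close>

lemma integrable_inverse_powr_decay:
  fixes p :: real
  assumes "p > 1"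
  shows "integrable lborel (\<lambda>x::real. (1 + \<bar>x\<bar>) powr (-p))"
proof -
  let ?f = "\<lambda>x::real. (1 + x) powr (-p)"
  let ?F = "\<lambda>x::real. (1 + x) powr (1 - p) / (1 - p)"
  have "(\<integral>\<^sup>+x. ennreal (?f x) * indicator {0..} x \<partial>lborel) = ennreal (0 - ?F 0)"
  proof (rule nn_integral_FTC_atLeast)
    show "DERIV ?F x :> ?f x" if "0 \<le> x" for x
    proof -
      have "(?F has_real_derivative (1 - p) * (1 + x) powr (1 - p - 1) / (1 - p)) (at x)"
        using that by (auto intro!: derivative_eq_intros)
      then show ?thesis using assms by simp
    qed
    show "(?F \<longlongrightarrow> 0) at_top"
      using assms by real_asymp
  qed (use assms in auto)
  then have fin: "(\<integral>\<^sup>+x. ennreal (?f x * indicator {0..} x) \<partial>lborel) < \<infinity>"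
    by (simp add: ennreal_mult'' ennreal_indicator)
  have "integrable lborel (\<lambda>x. ?f x * indicator {0..} x)"
    by (rule integrableI_nonneg[OF _ _ fin]) auto
  then have int: "integrable lborel (\<lambda>x. ?f x * indicator {0..} x)" .
  have int': "integrable lborel (\<lambda>x. ?f (0 + (-1) * x) * indicator {0..} (0 + (-1) * x))"
    by (rule lborel_integrable_real_affine[OF int]) simp
  show ?thesis
    by (rule Bochner_Integration.integrable_bound[OF Bochner_Integration.integrable_add[OF int int']])
       (auto simp: indicator_def)
qed

lemma norm_iexp_diff_le_powr:
  fixes u v \<gamma> :: real
  assumes "0 < \<gamma>" "\<gamma> \<le> 1"
  shows "norm (iexp u - iexp v) \<le> 2 * \<bar>u - v\<bar> powr \<gamma>"
proof -
  have "iexp u - iexp v = iexp v * (iexp (u - v) - 1)"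
    by (simp add: field_simps exp_diff)
  then have eq: "norm (iexp u - iexp v) = norm (iexp (u - v) - 1)"
    by (simp add: norm_mult)
  have le1: "norm (iexp (u - v) - 1) \<le> \<bar>u - v\<bar>"
    using iexp_approx1[of "u - v" 0] by simp
  have le2: "norm (iexp (u - v) - 1) \<le> 2"
    using norm_triangle_ineq4[of "iexp (u - v)" 1] by simp
  show ?thesis
  proof (cases "\<bar>u - v\<bar> \<le> 1")
    case True
    have "\<bar>u - v\<bar> \<le> \<bar>u - v\<bar> powr \<gamma>"
      using powr_mono'[of \<gamma> 1 "\<bar>u - v\<bar>"] True assms by simp
    then show ?thesis using eq le1 by (smt (verit))
  next
    case False
    then have "1 \<le> \<bar>u - v\<bar> powr \<gamma>"
      using assms by (simp add: ge_one_powr_ge_zero)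
    then show ?thesis using eq le2 by linarith
  qed
qed

text \<open>
  Fourier inversion. The inverse Fourier integral of an integrable characteristic function is a bounded
  density, and it inherits a Hoelder exponent \<open>\<gamma>\<close> as soon as \<open>\<bar>t\<bar> powr \<gamma>\<close> times the characteristic function
  is still integrable, that is, for \<open>\<gamma> < p - 1\<close>.
\<close>

lemma (in real_distribution) holder_density_of_char_decay:
  fixes C p :: real
  assumes atomless: "\<And>a. measure M {a} = 0"
    and "p > 1"
    and decay: "\<And>t. norm (char M t) \<le> C * (1 + \<bar>t\<bar>) powr (-p)"
  obtains h :: "real \<Rightarrow> real" and H L \<gamma> where
    "\<And>x. 0 \<le> h x" "\<And>x. h x \<le> H" "0 < \<gamma>" "\<gamma> \<le> 1"
    "\<And>x y. \<bar>h x - h y\<bar> \<le> L * \<bar>x - y\<bar> powr \<gamma>"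
    "M = density lborel (\<lambda>x. ennreal (h x))"
proof -
  define \<phi> where "\<phi> = char M"
  have \<phi>_meas[measurable]: "\<phi> \<in> borel_measurable borel"
    unfolding \<phi>_def by (rule char_measurable)
  define k where "k t = C * (1 + \<bar>t\<bar>) powr (-p)" for t :: real
  have k_int: "integrable lborel k"
    unfolding k_def by (intro integrable_mult_right integrable_inverse_powr_decay assms)
  have \<phi>_le: "norm (\<phi> t) \<le> k t" for t
    unfolding \<phi>_def k_def by (rule decay)
  have k_nonneg: "0 \<le> k t" for t
    using \<phi>_le[of t] norm_ge_zero order_trans by blast
  have \<phi>_int: "integrable lborel \<phi>"
    by (rule Bochner_Integration.integrable_bound[OF k_int]) (use \<phi>_le k_nonneg in auto)
  define I where "I x = (CLBINT t. iexp (-(t * x)) * \<phi> t)" for x :: real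
  have I_int: "integrable lborel (\<lambda>t. iexp (-(t * x)) * \<phi> t)" for x
    by (rule Bochner_Integration.integrable_bound[OF \<phi>_int]) (auto simp: norm_mult)
  define h where "h x = Re (I x) / (2 * pi)" for x
  \<comment> \<open>Any exponent in \<open>(0, 1]\<close> below \<open>p - 1\<close> works.\<close>
  define \<gamma> where "\<gamma> = min 1 ((p - 1) / 2)"
  have \<gamma>: "0 < \<gamma>" "\<gamma> \<le> 1" "p - \<gamma> > 1"
    using \<open>p > 1\<close> by (auto simp: \<gamma>_def min_def field_simps)
  define k' where "k' t = C * (1 + \<bar>t\<bar>) powr (-(p - \<gamma>))" for t :: real
  have k'_int: "integrable lborel k'"
    unfolding k'_def by (intro integrable_mult_right integrable_inverse_powr_decay \<gamma>)
  have I_diff: "norm (I x - I y) \<le> 2 * \<bar>x - y\<bar> powr \<gamma> * (LBINT t. k' t)" for x y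
  proof -
    have "I x - I y = (CLBINT t. iexp (-(t * x)) * \<phi> t - iexp (-(t * y)) * \<phi> t)"
      unfolding I_def by (rule Bochner_Integration.integral_diff[symmetric, OF I_int I_int])
    also have "norm \<dots> \<le> (LBINT t. 2 * \<bar>x - y\<bar> powr \<gamma> * k' t)"
    proof (rule Bochner_Integration.integral_norm_bound_integral)
      show "norm (iexp (- (t * x)) * \<phi> t - iexp (- (t * y)) * \<phi> t)
          \<le> 2 * \<bar>x - y\<bar> powr \<gamma> * k' t" for t
      proof -
        have "norm (iexp (- (t * x)) * \<phi> t - iexp (- (t * y)) * \<phi> t)
            = norm (iexp (- (t * x)) - iexp (- (t * y))) * norm (\<phi> t)"
          by (simp add: norm_mult[symmetric] algebra_simps)
        also have "\<dots> \<le> (2 * \<bar>- (t * x) - - (t * y)\<bar> powr \<gamma>) * k t"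
          by (intro mult_mono \<phi>_le norm_iexp_diff_le_powr \<gamma>) auto
        also have "\<bar>- (t * x) - - (t * y)\<bar> = \<bar>t\<bar> * \<bar>x - y\<bar>"
          by (simp add: abs_mult[symmetric] algebra_simps abs_minus_commute)
        also have "(\<bar>t\<bar> * \<bar>x - y\<bar>) powr \<gamma> \<le> (1 + \<bar>t\<bar>) powr \<gamma> * \<bar>x - y\<bar> powr \<gamma>"
          using \<gamma> by (subst powr_mult) (auto intro!: mult_right_mono powr_mono2)
        also have "2 * ((1 + \<bar>t\<bar>) powr \<gamma> * \<bar>x - y\<bar> powr \<gamma>) * k t
            = 2 * \<bar>x - y\<bar> powr \<gamma> * k' t"
          by (simp add: k_def k'_def powr_add[symmetric] powr_diff powr_minus field_simps)
        finally show ?thesis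
          using k_nonneg by (simp add: mult_left_mono mult_right_mono)
      qed
    qed (intro Bochner_Integration.integrable_diff I_int integrable_mult_right k'_int)+
    finally show ?thesis by simp
  qed
  have abs_h: "\<bar>h x - h y\<bar> \<le> norm (I x - I y)" for x y
  proof -
    have "\<bar>h x - h y\<bar> = \<bar>Re (I x - I y)\<bar> / (2 * pi)"
      by (simp add: h_def diff_divide_distrib[symmetric])
    also have "\<dots> \<le> norm (I x - I y) / 1"
      using pi_gt3 by (intro frac_le abs_Re_le_cmod) auto
    finally show ?thesis by simp
  qed
  have h_holder: "\<bar>h x - h y\<bar> \<le> 2 * (LBINT t. k' t) * \<bar>x - y\<bar> powr \<gamma>" for x y
    using abs_h[of x y] I_diff[of x y] by (simp add: mult_ac)
  have h_cont: "continuous_on A h" for A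
    by (rule continuous_on_of_holder_bound[OF \<gamma>(1)]) (use h_holder in auto)
  have h_tendsto: "isCont h x" for x
    using h_cont[of UNIV] by (simp add: continuous_on_eq_continuous_at)
  have h_meas[measurable]: "h \<in> borel_measurable borel"
    using h_cont borel_measurable_continuous_onI by blast
  have h_le: "h x \<le> (LBINT t. k t)" for x
  proof -
    have "\<bar>h x\<bar> = \<bar>Re (I x)\<bar> / (2 * pi)"
      by (simp add: h_def)
    also have "\<dots> \<le> norm (I x) / 1"
      using pi_gt3 by (intro frac_le abs_Re_le_cmod) auto
    also have "norm (I x) \<le> (LBINT t. k t)"
      unfolding I_def
      by (intro Bochner_Integration.integral_norm_bound_integral I_int k_int) (simp add: norm_mult \<phi>_le)
    finally show ?thesis by simp
  qed
  \<comment> \<open>The truncated integrals of Levy's inversion formula converge, by integrability of \<open>\<phi>\<close>,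
    and Fubini turns the limit into an integral of \<open>h\<close>.\<close>
  have measure_eq: "measure M {a<..b} = (LBINT x:{a..b}. h x)" if "a \<le> b" for a b
  proof -
    define \<psi> where "\<psi> t = (iexp (-(t * a)) - iexp (-(t * b))) / (\<i> * t) * \<phi> t" for t :: real
    have \<psi>_le: "norm (\<psi> t) \<le> (b - a) * k t" for t
    proof (cases "t = 0")
      case False
      then have "norm ((iexp (-(t * a)) - iexp (-(t * b))) / (\<i> * t)) \<le> b - a"
        using Levy_Inversion_aux2[of "-b" "-a" t] that by simp
      then show ?thesis
        unfolding \<psi>_def norm_mult by (intro mult_mono \<phi>_le) (use that in auto)
    qed (use that k_nonneg in \<open>simp add: \<psi>_def\<close>)
    have \<psi>_meas[measurable]: "\<psi> \<in> borel_measurable borel"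
      unfolding \<psi>_def by measurable
    have "(\<lambda>n. CLBINT t:{-real n<..<real n}. \<psi> t) \<longlonglongrightarrow> (CLBINT t. \<psi> t)"
      unfolding set_lebesgue_integral_def
    proof (rule integral_dominated_convergence[where w="\<lambda>t. (b - a) * k t"])
      show "AE x in lborel. (\<lambda>i. indicator {- real i<..<real i} x *\<^sub>R \<psi> x) \<longlonglongrightarrow> \<psi> x"
      proof (rule AE_I2)
        fix x :: real
        have "eventually (\<lambda>i. \<bar>x\<bar> < real i) sequentially"
          using eventually_gt_at_top[of "nat \<lceil>\<bar>x\<bar>\<rceil>"] by eventually_elim linarith
        then have "eventually (\<lambda>i. indicator {- real i<..<real i} x *\<^sub>R \<psi> x = \<psi> x) sequentially"
          by eventually_elim (auto simp: indicator_def)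
        then show "(\<lambda>i. indicator {- real i<..<real i} x *\<^sub>R \<psi> x) \<longlonglongrightarrow> \<psi> x"
          by (rule tendsto_eventually)
      qed
      show "AE x in lborel. norm (indicator {- real i<..<real i} x *\<^sub>R \<psi> x) \<le> (b - a) * k x" for i
        using \<psi>_le k_nonneg that by (auto simp: indicator_def)
    qed (use k_int in auto)
    then have lim1: "(\<lambda>n. 1 / (2 * pi) * (CLBINT t=-real n..real n. \<psi> t))
        \<longlonglongrightarrow> 1 / (2 * pi) * (CLBINT t. \<psi> t)"
      by (auto intro!: tendsto_intros simp: interval_lebesgue_integral_def einterval_eq)
    moreover have "(\<lambda>n. 1 / (2 * pi) * (CLBINT t=-real n..real n. \<psi> t))
        \<longlonglongrightarrow> of_real (measure M {a<..b})"
      unfolding \<psi>_def \<phi>_def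
      using Levy_Inversion[OF that atomless atomless] by simp
    ultimately have "of_real (measure M {a<..b}) = 1 / (2 * pi) * (CLBINT t. \<psi> t)"
      using LIMSEQ_unique by blast
    also have "(CLBINT t. \<psi> t) = (CLBINT t. CLBINT x. indicator {a..b} x *\<^sub>R (iexp (-(t * x)) * \<phi> t))"
    proof (rule integral_cong_AE)
      have "AE t in lborel. t \<noteq> (0::real)"
        by (rule AE_lborel_singleton)
      then show "AE t in lborel. \<psi> t = (CLBINT x. indicator {a..b} x *\<^sub>R (iexp (-(t * x)) * \<phi> t))"
      proof eventually_elim
        fix t :: real assume "t \<noteq> 0"
        let ?G = "\<lambda>x. iexp (-(t * x)) / (- \<i> * t)"
        have "(CLBINT x. indicator {a..b} x *\<^sub>R iexp (-(t * x))) = ?G b - ?G a"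
        proof (rule integral_FTC_Icc)
          fix x
          show "(?G has_vector_derivative iexp (-(t * x))) (at x within {a..b})"
          proof -
            have ii: "- (\<i> * (z * \<i>)) = z" for z
              by (simp add: complex_eq_iff)
            have "((\<lambda>z. exp (- (\<i> * (of_real t * z))) / (- \<i> * t)) has_field_derivative
                exp (- (\<i> * (of_real t * of_real x)))) (at (of_real x))"
              using \<open>t \<noteq> 0\<close> by (auto intro!: derivative_eq_intros simp: ii)
            from has_vector_derivative_real_field[OF this, of "{a..b}"]
            show ?thesis by simp
          qed
        qed (use that in \<open>auto intro!: continuous_intros\<close>)
        moreover have "(CLBINT x. indicator {a..b} x *\<^sub>R (iexp (-(t * x)) * \<phi> t))
            = (CLBINT x. indicator {a..b} x *\<^sub>R iexp (-(t * x))) * \<phi> t"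
          by (simp only: mult_scaleR_left[symmetric] integral_mult_left_zero)
        moreover have "(iexp (-(t * a)) - iexp (-(t * b))) / (\<i> * t) = ?G b - ?G a"
          by (simp add: diff_divide_distrib)
        ultimately show "\<psi> t = (CLBINT x. indicator {a..b} x *\<^sub>R (iexp (-(t * x)) * \<phi> t))"
          unfolding \<psi>_def by simp
      qed
    qed measurable
    also have "\<dots> = (CLBINT x. CLBINT t. indicator {a..b} x *\<^sub>R (iexp (-(t * x)) * \<phi> t))"
    proof (rule lborel_pair.Fubini_integral[symmetric], rule lborel_pair.Fubini_integrable)
      have "integrable lborel (\<lambda>x. norm (\<phi> x) * (b - a))"
        using \<phi>_int by auto
      then show "integrable lborel (\<lambda>x. LINT y|lborel. norm (case (x, y) of (t, x) \<Rightarrow>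
            indicator {a..b} x *\<^sub>R (iexp (-(t * x)) * \<phi> t)))"
        using that by (simp add: norm_mult)
      show "AE x in lborel. integrable lborel (\<lambda>y. case (x, y) of (t, x) \<Rightarrow>
            indicator {a..b} x *\<^sub>R (iexp (-(t * x)) * \<phi> t))"
      proof (rule AE_I2)
        fix t :: real
        have "integrable lborel (\<lambda>x. indicator {a..b} x *\<^sub>R norm (\<phi> t))"
          by (intro integrable_scaleR_left integrable_real_indicator) (auto simp: emeasure_lborel_Icc_eq)
        then show "integrable lborel (\<lambda>y. case (t, y) of (t, x) \<Rightarrow>
            indicator {a..b} x *\<^sub>R (iexp (-(t * x)) * \<phi> t))"
          by (rule Bochner_Integration.integrable_bound) (auto simp: norm_mult)
      qed
    qed measurable
    also have "\<dots> = (CLBINT x. indicator {a..b} x *\<^sub>R I x)"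
      by (simp add: I_def)
    finally have "measure M {a<..b} = Re (1 / (2 * pi) * (CLBINT x. indicator {a..b} x *\<^sub>R I x))"
      by (metis Re_complex_of_real)
    also have "\<dots> = (Re (CLBINT x. indicator {a..b} x *\<^sub>R I x)) / (2 * pi)"
      by (simp only: times_complex.sel Re_complex_of_real Im_complex_of_real) simp
    also have "Re (CLBINT x. indicator {a..b} x *\<^sub>R I x) = (LBINT x. Re (indicator {a..b} x *\<^sub>R I x))"
    proof (rule integral_Re[symmetric])
      have "continuous_on {a..b} I"
        by (rule continuous_on_of_holder_bound[OF \<gamma>(1), where L = "2 * (LBINT t. k' t)"])
           (use I_diff in \<open>simp add: mult_ac\<close>)
      then show "integrable lborel (\<lambda>x. indicator {a..b} x *\<^sub>R I x)"
        by (rule borel_integrable_compact[OF compact_Icc])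
    qed
    also have "\<dots> / (2 * pi) = (LBINT x:{a..b}. h x)"
      by (simp add: set_lebesgue_integral_def h_def)
    finally show ?thesis .
  qed
  have h_nonneg: "0 \<le> h x" for x
  proof (rule ccontr)
    assume neg: "\<not> 0 \<le> h x"
    have "eventually (\<lambda>y. h y < h x / 2) (nhds x)"
      using h_tendsto[of x] neg by (intro order_tendstoD(2)) (auto simp: isCont_def tendsto_at_iff_tendsto_nhds)
    then obtain d where d: "d > 0" "\<And>y. dist y x < d \<Longrightarrow> h y < h x / 2"
      by (auto simp: eventually_nhds_metric)
    have "(LBINT y:{x..x + d / 2}. h y) \<le> (LBINT y:{x..x + d / 2}. h x / 2)"
      using d by (intro set_integral_mono borel_integrable_compact[folded set_integrable_def])
        (auto intro!: h_cont continuous_intros less_imp_le simp: dist_real_def)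
    also have "\<dots> = d / 2 * (h x / 2)"
      using d by (simp add: set_lebesgue_integral_def)
    also have "\<dots> < 0"
      using d neg by (auto intro!: mult_pos_neg)
    finally show False
      using measure_eq[of x "x + d / 2"] d measure_nonneg[of M "{x<..x + d / 2}"] by auto
  qed
  have "M = density lborel (\<lambda>x. ennreal (h x))"
  proof (rule measure_eqI_generator_eq[where \<Omega>=UNIV])
    fix X assume "X \<in> range (\<lambda>(a, b). {a<..b::real})"
    then obtain a b where X: "X = {a<..b}" by auto
    show "emeasure M X = emeasure (density lborel (\<lambda>x. ennreal (h x))) X"
    proof (cases "a \<le> b")
      case True
      have "emeasure (density lborel (\<lambda>x. ennreal (h x))) X
          = (\<integral>\<^sup>+x. ennreal (h x) * indicator {a<..b} x \<partial>lborel)"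
        by (simp add: X emeasure_density)
      also have "\<dots> = (\<integral>\<^sup>+x. ennreal (indicator {a..b} x *\<^sub>R h x) \<partial>lborel)"
        using AE_lborel_singleton[of a]
        by (intro nn_integral_cong_AE) (auto simp: indicator_def)
      also have "\<dots> = ennreal (LBINT x:{a..b}. h x)"
        unfolding set_lebesgue_integral_def
        by (intro nn_integral_eq_integral borel_integrable_compact h_cont)
           (auto simp: h_nonneg)
      also have "\<dots> = emeasure M X"
        using measure_eq[OF True] by (simp add: X emeasure_eq_measure)
      finally show ?thesis ..
    qed (simp add: X)
  next
    show "(\<Union>i. {-real (i::nat)<..real i}) = UNIV"
      by (rule UN_Ioc_eq_UNIV)
  qed (auto simp: Int_stable_def borel_sigma_sets_Ioc emeasure_eq_measure)
  then show ?thesis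
    using that[of h] h_nonneg h_le \<gamma> h_holder by blast
qed

text \<open>
  A continuous density cannot be positive at a point outside an interval of full measure, since it would
  then be positive on a whole neighbourhood. This turns the almost sure bound on \<open>\<Theta>\<close> into a pointwise
  statement about its density.
\<close>

lemma density_eq_0_outside:
  fixes h :: "real \<Rightarrow> real"
  assumes cont: "continuous_on UNIV h" and nonneg: "\<And>x. 0 \<le> h x"
    and AE: "AE x in density lborel (\<lambda>x. ennreal (h x)). \<bar>x\<bar> \<le> B" and x: "B < \<bar>x\<bar>"
  shows "h x = 0"
proof (rule ccontr)
  assume "h x \<noteq> 0"
  then have "0 < h x" using nonneg[of x] by simp
  have [measurable]: "h \<in> borel_measurable borel"
    using cont by (rule borel_measurable_continuous_onI)
  let ?V = "{y. 0 < h y} \<inter> {y. B < \<bar>y\<bar>}"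
  have "open ?V"
    by (intro open_Int open_Collect_less continuous_intros continuous_on_subset[OF cont]) auto
  moreover have "x \<in> ?V" using x \<open>0 < h x\<close> by simp
  ultimately obtain d where d: "0 < d" "ball x d \<subseteq> ?V"
    using openE by blast
  have "AE y in lborel. 0 < h y \<longrightarrow> \<bar>y\<bar> \<le> B"
    using AE by (subst (asm) AE_density) auto
  then have "AE y in lborel. y \<notin> ball x d"
    by eventually_elim (use d in auto)
  then have "emeasure lborel (ball x d) = 0"
    by (subst (asm) AE_iff_measurable[where N = "ball x d"]) auto
  moreover have "ball x d = {x - d<..<x + d}"
    by (auto simp: dist_real_def)
  ultimately show False using d by simp
qed

section \<open>A martingale of random densities indexed by words\<close>

definition words :: "nat \<Rightarrow> nat \<Rightarrow> nat list set" where
  "words N n = {w \<in> lists {1..N}. length w = n}"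

lemma finite_words[simp]: "finite (words N n)"
  using finite_lists_length_eq[of "{1..N}" n]
  by (rule rev_finite_subset) (auto simp: words_def lists_eq_set)

lemma sum_words_Suc:
  "(\<Sum>w\<in>words N (Suc n). g w) = (\<Sum>w\<in>words N n. \<Sum>i=1..N. g (w @ [i]))"
proof -
  have "words N (Suc n) = (\<lambda>(w, i). w @ [i]) ` (words N n \<times> {1..N})"
  proof (intro equalityI subsetI)
    fix v assume "v \<in> words N (Suc n)"
    then have "v \<noteq> []" "v \<in> lists {1..N}" "length v = Suc n" by (auto simp: words_def)
    then show "v \<in> (\<lambda>(w, i). w @ [i]) ` (words N n \<times> {1..N})"
      by (intro image_eqI[of _ _ "(butlast v, last v)"])
        (auto simp: words_def in_lists_conv_set dest: in_set_butlastD)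
  qed (auto simp: words_def)
  moreover have "inj_on (\<lambda>(w, i). w @ [i]) (words N n \<times> {1..N})"
    by (auto simp: inj_on_def)
  ultimately show ?thesis
    by (simp add: sum.reindex sum.cartesian_product split_def)
qed

text \<open>
  The contribution of the perturbations at the proper prefixes of \<open>w\<close>. It is the same for all sequences
  in the cylinder of \<open>w\<close>, so it translates the whole part of the measure carried by that cylinder.
\<close>

definition word_shift :: "(nat \<Rightarrow> real) \<Rightarrow> (nat list \<Rightarrow> real) \<Rightarrow> nat list \<Rightarrow> real" where
  "word_shift lam \<theta> w = (\<Sum>j<length w. word_ratio lam (take j w) * \<theta> (take j w))"

lemma word_shift_snoc: "word_shift lam \<theta> (w @ [i]) = word_shift lam \<theta> w + word_ratio lam w * \<theta> w"
  by (simp add: word_shift_def)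

lemma exp_le_one_plus_square:
  fixes u :: real
  assumes "\<bar>u\<bar> \<le> 1"
  shows "exp u \<le> 1 + u + u\<^sup>2"
proof (cases "0 \<le> u")
  case True
  then show ?thesis using exp_bound[of u] assms by simp
next
  case False
  have "1 - u \<le> exp (- u)" using exp_ge_add_one_self[of "-u"] by simp
  then have "exp u * (1 - u) \<le> exp u * exp (- u)" by (intro mult_left_mono) auto
  also have "\<dots> = 1" by (simp add: exp_minus)
  also have "1 \<le> (1 + u + u\<^sup>2) * (1 - u)"
  proof -
    have "u * (u * u) \<le> 0" using False by (intro mult_nonpos_nonneg) auto
    then show ?thesis by (simp add: algebra_simps power2_eq_square)
  qed
  finally show ?thesis using False by (simp add: mult_le_cancel_right)
qed

text \<open>
  For small \<open>c\<close> one has \<open>exp (c * Y) \<le> 1 + c * Y + (c * Y)\<^sup>2\<close>, and boundedness makes the quadratic term at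
  most \<open>Y\<close>. The second moment is thus absorbed by the first, which is why the compensator may be written
  with the mean of \<open>Y\<close> only. The sign of \<open>c\<close> is free, so both tails are covered.
\<close>

lemma (in prob_space) exp_moment_le_one:
  fixes Y :: "'a \<Rightarrow> real"
  assumes [measurable]: "Y \<in> borel_measurable M"
    and Y: "\<And>x. 0 \<le> Y x" "\<And>x. Y x \<le> b"
    and c: "\<bar>c\<bar> * b \<le> 1" "c\<^sup>2 * b \<le> 1"
  shows "(\<integral>\<^sup>+x. ennreal (exp (c * Y x - (c + 1) * expectation Y)) \<partial>M) \<le> 1"
proof -
  let ?m = "expectation Y"
  have int: "integrable M Y"
    by (rule integrable_const_bound[of _ b]) (use Y in auto)
  have pointwise: "exp (c * Y x) \<le> 1 + (c + 1) * Y x" for x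
  proof -
    have "\<bar>c\<bar> * Y x \<le> \<bar>c\<bar> * b"
      using Y by (intro mult_left_mono) auto
    then have "\<bar>c * Y x\<bar> \<le> 1"
      using c Y(1)[of x] by (simp add: abs_mult)
    then have "exp (c * Y x) \<le> 1 + c * Y x + (c * Y x)\<^sup>2"
      by (rule exp_le_one_plus_square)
    also have "(c * Y x)\<^sup>2 = c\<^sup>2 * Y x * Y x"
      by (simp add: power2_eq_square)
    also have "\<dots> \<le> c\<^sup>2 * b * Y x"
      using Y by (intro mult_right_mono mult_left_mono) auto
    also have "\<dots> \<le> 1 * Y x"
      using c Y by (intro mult_right_mono) auto
    finally show ?thesis by (simp add: algebra_simps)
  qed
  have "(\<integral>\<^sup>+x. ennreal (exp (c * Y x - (c + 1) * ?m)) \<partial>M)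
      \<le> (\<integral>\<^sup>+x. ennreal ((1 + (c + 1) * Y x) * exp (- ((c + 1) * ?m))) \<partial>M)"
    unfolding exp_diff divide_inverse exp_minus
    using pointwise by (intro nn_integral_mono ennreal_leI mult_right_mono) auto
  also have "\<dots> = ennreal (\<integral>x. (1 + (c + 1) * Y x) * exp (- ((c + 1) * ?m)) \<partial>M)"
    using int pointwise order_trans[OF exp_ge_zero pointwise] by (intro nn_integral_eq_integral) auto
  finally have le: "(\<integral>\<^sup>+x. ennreal (exp (c * Y x - (c + 1) * ?m)) \<partial>M)
      \<le> ennreal (\<integral>x. (1 + (c + 1) * Y x) * exp (- ((c + 1) * ?m)) \<partial>M)" .
  have "(\<integral>x. (1 + (c + 1) * Y x) * exp (- ((c + 1) * ?m)) \<partial>M)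
      = (1 + (c + 1) * ?m) * exp (- ((c + 1) * ?m))"
    using int by (simp add: prob_space)
  also have "\<dots> \<le> exp ((c + 1) * ?m) * exp (- ((c + 1) * ?m))"
    by (intro mult_right_mono) (auto simp: exp_ge_add_one_self)
  also have "\<dots> = 1" by (simp add: exp_minus)
  finally have "ennreal (\<integral>x. (1 + (c + 1) * Y x) * exp (- ((c + 1) * ?m)) \<partial>M) \<le> 1" by simp
  with le show ?thesis by (rule order_trans)
qed

lemma prod_ennreal_le_one:
  fixes g :: "'b \<Rightarrow> ennreal"
  assumes "finite A" "\<And>a. a \<in> A \<Longrightarrow> g a \<le> 1"
  shows "prod g A \<le> 1"
  using assms
proof (induction A)
  case (insert a A)
  then have "g a * prod g A \<le> 1 * 1" by (intro mult_mono) auto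
  then show ?case using insert by simp
qed simp

text \<open>
  The properties of the conditional densities of the pieces on which the concentration argument rests:
  \<open>children_mean\<close> is the martingale property, obtained by averaging over the perturbation at \<open>w\<close>, and
  \<open>children_le\<close> makes each independent summand of an increment exponentially small. The square \<open>\<rho> ^ (2 * n)\<close>
  is convenient because fluctuations have the size of its square root.
\<close>

locale density_martingale =
  fixes N :: nat and lam :: "nat \<Rightarrow> real" and D :: "real measure"
    and piece :: "nat list \<Rightarrow> real \<Rightarrow> real" and K \<rho> :: real
  assumes D: "real_distribution D"
    and K: "1 \<le> K" and \<rho>: "0 < \<rho>" "\<rho> < 1"
    and piece_measurable: "\<And>w. w \<in> lists {1..N} \<Longrightarrow> piece w \<in> borel_measurable borel"
    and piece_nonneg: "\<And>w y. w \<in> lists {1..N} \<Longrightarrow> 0 \<le> piece w y"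
    and children_le: "\<And>w y. w \<in> lists {1..N} \<Longrightarrow>
        (\<Sum>i=1..N. piece (w @ [i]) y) \<le> K * \<rho> ^ (2 * length w)"
    and children_mean: "\<And>w y. w \<in> lists {1..N} \<Longrightarrow>
        (LINT \<xi>|D. (\<Sum>i=1..N. piece (w @ [i]) (y - word_ratio lam w * \<xi>))) = piece w y"
begin

sublocale D: real_distribution D by (rule D)

sublocale PP: product_prob_space "\<lambda>_::nat list. D" UNIV
  by unfold_locales

abbreviation "law \<equiv> perturbation_law N D"

sublocale law: prob_space law
  unfolding perturbation_law_def by (intro prob_space_PiM D.prob_space_axioms)

text \<open>
  The density at \<open>x\<close> of the conditional expectation of the random measure, given the perturbations at the
  words shorter than \<open>n\<close>.
\<close>

definition level_density :: "nat \<Rightarrow> (nat list \<Rightarrow> real) \<Rightarrow> real \<Rightarrow> real" where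
  "level_density n \<theta> x = (\<Sum>w\<in>words N n. piece w (x - word_shift lam \<theta> w))"

lemma level_density_Suc:
  "level_density (Suc n) \<theta> x = (\<Sum>w\<in>words N n. \<Sum>i=1..N.
      piece (w @ [i]) (x - word_shift lam \<theta> w - word_ratio lam w * \<theta> w))"
  by (simp add: level_density_def sum_words_Suc word_shift_snoc diff_diff_eq)

lemma words_in_lists: "w \<in> words N n \<Longrightarrow> w \<in> lists {1..N}"
  by (simp add: words_def)

lemma word_shift_measurable:
  assumes "w \<in> lists {1..N}" "\<And>j. j < length w \<Longrightarrow> take j w \<in> A"
  shows "(\<lambda>\<theta>. word_shift lam \<theta> w) \<in> borel_measurable (PiM A (\<lambda>_. D))"
  unfolding word_shift_def
proof (intro borel_measurable_sum borel_measurable_times borel_measurable_const)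
  fix j assume "j \<in> {..<length w}"
  then have "take j w \<in> A" using assms by auto
  then have "(\<lambda>\<theta>. \<theta> (take j w)) \<in> measurable (PiM A (\<lambda>_. D)) D"
    by (rule measurable_component_singleton)
  then show "(\<lambda>\<theta>. \<theta> (take j w)) \<in> borel_measurable (PiM A (\<lambda>_. D))"
    using measurable_cong_sets[OF refl D.events_eq_borel] by blast
qed

lemma level_density_measurable:
  assumes "\<And>w. w \<in> lists {1..N} \<Longrightarrow> length w < n \<Longrightarrow> w \<in> A"
  shows "(\<lambda>\<theta>. level_density n \<theta> x) \<in> borel_measurable (PiM A (\<lambda>_. D))"
  unfolding level_density_def
proof (intro borel_measurable_sum)
  fix w assume w: "w \<in> words N n"
  then have "(\<lambda>\<theta>. word_shift lam \<theta> w) \<in> borel_measurable (PiM A (\<lambda>_. D))"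
    by (intro word_shift_measurable) (auto simp: words_def intro!: assms dest: in_set_takeD)
  then have "(\<lambda>\<theta>. x - word_shift lam \<theta> w) \<in> borel_measurable (PiM A (\<lambda>_. D))"
    by simp
  from measurable_compose[OF this piece_measurable[OF words_in_lists[OF w]]]
  show "(\<lambda>\<theta>. piece w (x - word_shift lam \<theta> w)) \<in> borel_measurable (PiM A (\<lambda>_. D))" .
qed

lemma level_density_cong:
  assumes "\<And>w. w \<in> lists {1..N} \<Longrightarrow> length w < n \<Longrightarrow> \<theta> w = \<theta>' w"
  shows "level_density n \<theta> x = level_density n \<theta>' x"
proof -
  have "word_shift lam \<theta> w = word_shift lam \<theta>' w" if "w \<in> words N n" for w
  proof -
    have "\<theta> (take j w) = \<theta>' (take j w)" if "j < length w" for j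
      by (rule assms) (use that \<open>w \<in> words N n\<close> in \<open>auto simp: words_def dest: in_set_takeD\<close>)
    then show ?thesis by (simp add: word_shift_def)
  qed
  then show ?thesis by (simp add: level_density_def)
qed

text \<open>
  Conditionally on the words shorter than \<open>n\<close>, the next level is a sum of independent terms, one for each
  word \<open>w\<close> of length \<open>n\<close>, and the exponential factorises. Each factor is at most 1 by
  \<open>exp_moment_le_one\<close>, and the compensators of the factors add up to the terms of the exponent that
  involve \<open>level_density n\<close>.
\<close>

lemma nn_integral_increment_le_one:
  assumes "\<bar>c\<bar> = 1"
  shows "(\<integral>\<^sup>+\<theta>. ennreal (exp (c / (K * \<rho> ^ n) * (level_density (Suc n) \<theta> x - level_density n \<theta> x) - level_density n \<theta> x)) \<partial>law) \<le> 1"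
proof -
  define J where "J = {w \<in> lists {1..N}. length w < n}"
  define I where "I = words N n"
  define d where "d = c / (K * \<rho> ^ n)"
  define F where "F \<theta> = ennreal (exp (d * (level_density (Suc n) \<theta> x - level_density n \<theta> x) - level_density n \<theta> x))" for \<theta>
  define G where "G w y = (\<Sum>i=1..N. piece (w @ [i]) y)" for w y
  have fin: "finite J" "finite I" and disj: "J \<inter> I = {}" and sub: "J \<union> I \<subseteq> lists {1..N}"
  proof -
    have "J = (\<Union>k<n. words N k)" by (auto simp: J_def words_def)
    then show "finite J" by simp
    show "finite I" by (simp add: I_def)
  qed (auto simp: J_def I_def words_def)
  have F_meas: "F \<in> borel_measurable (PiM (J \<union> I) (\<lambda>_. D))"
  proof -
    have [measurable]: "(\<lambda>\<theta>. level_density n \<theta> x) \<in> borel_measurable (PiM (J \<union> I) (\<lambda>_. D))"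
      "(\<lambda>\<theta>. level_density (Suc n) \<theta> x) \<in> borel_measurable (PiM (J \<union> I) (\<lambda>_. D))"
      by (intro level_density_measurable; auto simp: J_def I_def words_def)+
    show ?thesis unfolding F_def by measurable
  qed
  have F_restrict: "F (restrict \<theta> (J \<union> I)) = F \<theta>" for \<theta>
  proof -
    have "level_density k (restrict \<theta> (J \<union> I)) x = level_density k \<theta> x" if "k \<le> Suc n" for k
      using that by (intro level_density_cong) (auto simp: J_def I_def words_def)
    then show ?thesis by (simp add: F_def)
  qed
  have "(\<integral>\<^sup>+\<theta>. F \<theta> \<partial>law) = (\<integral>\<^sup>+\<theta>. F (restrict \<theta> (J \<union> I)) \<partial>PiM (lists {1..N}) (\<lambda>_. D))"
    by (simp add: F_restrict perturbation_law_def)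
  also have "\<dots> = (\<integral>\<^sup>+\<theta>. F \<theta> \<partial>distr (PiM (lists {1..N}) (\<lambda>_. D)) (PiM (J \<union> I) (\<lambda>_. D)) (\<lambda>\<theta>. restrict \<theta> (J \<union> I)))"
    by (rule nn_integral_distr[symmetric, OF measurable_restrict_subset[OF sub]]) (simp add: F_meas)
  also have "distr (PiM (lists {1..N}) (\<lambda>_. D)) (PiM (J \<union> I) (\<lambda>_. D)) (\<lambda>\<theta>. restrict \<theta> (J \<union> I))
      = PiM (J \<union> I) (\<lambda>_. D)"
  proof -
    interpret L: product_prob_space "\<lambda>_::nat list. D" "lists {1..N}" by unfold_locales
    show ?thesis using fin sub by (intro L.distr_PiM_restrict_finite) auto
  qed
  also have "(\<integral>\<^sup>+\<theta>. F \<theta> \<partial>PiM (J \<union> I) (\<lambda>_. D)) =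
      (\<integral>\<^sup>+u. \<integral>\<^sup>+v. F (merge J I (u, v)) \<partial>PiM I (\<lambda>_. D) \<partial>PiM J (\<lambda>_. D))"
    by (rule PP.product_nn_integral_fold[OF disj fin F_meas])
  also have "\<dots> \<le> (\<integral>\<^sup>+u. 1 \<partial>PiM J (\<lambda>_. D))"
  proof (rule nn_integral_mono)
    fix u
    define y where "y w = x - word_shift lam u w" for w
    define f where "f w \<xi> = ennreal (exp (d * G w (y w - word_ratio lam w * \<xi>) - (d + 1) * piece w (y w)))" for w \<xi>
    have G_meas: "G w \<in> borel_measurable borel" if "w \<in> I" for w
      unfolding G_def using that
      by (intro borel_measurable_sum piece_measurable) (auto simp: I_def words_def)
    have F_eq: "F (merge J I (u, v)) = (\<Prod>w\<in>I. f w (v w))" for v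
    proof -
      have sh: "word_shift lam (merge J I (u, v)) w = word_shift lam u w" if "w \<in> I" for w
      proof -
        have "merge J I (u, v) (take j w) = u (take j w)" if "j < length w" for j
          using that \<open>w \<in> I\<close> by (auto simp: merge_def I_def J_def words_def dest: in_set_takeD)
        then show ?thesis by (simp add: word_shift_def)
      qed
      have v: "merge J I (u, v) w = v w" if "w \<in> I" for w
        using that disj by (auto simp: merge_def)
      \<comment> \<open>The translations \<open>y w\<close> depend only on the shorter words \<open>u\<close>, and each factor on one coordinate
        of \<open>v\<close>; this is what makes the integral over \<open>v\<close> a product.\<close>
      have 1: "level_density (Suc n) (merge J I (u, v)) x = (\<Sum>w\<in>I. G w (y w - word_ratio lam w * v w))"
        unfolding level_density_Suc I_def[symmetric] G_def y_def by (simp add: sh v)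
      have 2: "level_density n (merge J I (u, v)) x = (\<Sum>w\<in>I. piece w (y w))"
        unfolding level_density_def I_def[symmetric] y_def by (simp add: sh)
      have "F (merge J I (u, v)) = ennreal (exp (\<Sum>w\<in>I.
          d * G w (y w - word_ratio lam w * v w) - (d + 1) * piece w (y w)))"
        unfolding F_def 1 2 by (simp add: sum_subtractf sum.distrib sum_distrib_left[symmetric] algebra_simps)
      also have "\<dots> = (\<Prod>w\<in>I. f w (v w))"
        using fin unfolding f_def by (subst exp_sum) (auto simp: prod_ennreal)
      finally show ?thesis .
    qed
    have f_meas: "f w \<in> borel_measurable D" if "w \<in> I" for w
    proof -
      note [measurable] = G_meas[OF that]
      show ?thesis unfolding f_def by measurable
    qed
    have "(\<integral>\<^sup>+v. F (merge J I (u, v)) \<partial>PiM I (\<lambda>_. D)) = (\<Prod>w\<in>I. \<integral>\<^sup>+\<xi>. f w \<xi> \<partial>D)"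
      unfolding F_eq by (rule PP.product_nn_integral_prod[OF fin(2) f_meas])
    also have "\<dots> \<le> 1"
    proof (rule prod_ennreal_le_one[OF fin(2)])
      fix w assume w: "w \<in> I"
      then have w': "w \<in> lists {1..N}" "length w = n" by (auto simp: I_def words_def)
      note [measurable] = G_meas[OF w]
      have "0 < K * \<rho> ^ n" using K \<rho> by simp
      have mean: "(LINT \<xi>|D. G w (y w - word_ratio lam w * \<xi>)) = piece w (y w)"
        unfolding G_def by (rule children_mean[OF w'(1)])
      show "(\<integral>\<^sup>+\<xi>. f w \<xi> \<partial>D) \<le> 1"
        unfolding f_def mean[symmetric]
      proof (rule D.exp_moment_le_one[where b = "K * \<rho> ^ (2 * n)"])
        show "0 \<le> G w (y w - word_ratio lam w * \<xi>)" for \<xi>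
          unfolding G_def using w' by (intro sum_nonneg piece_nonneg) auto
        show "G w (y w - word_ratio lam w * \<xi>) \<le> K * \<rho> ^ (2 * n)" for \<xi>
          using children_le[OF w'(1)] w' by (simp add: G_def)
        have "\<bar>d\<bar> * (K * \<rho> ^ (2 * n)) = \<rho> ^ n"
          using K \<rho> assms by (simp add: d_def abs_mult power_mult_distrib power_even_eq power2_eq_square)
        then show "\<bar>d\<bar> * (K * \<rho> ^ (2 * n)) \<le> 1"
          using \<rho> by (simp add: power_le_one)
        have "d\<^sup>2 = 1 / (K * \<rho> ^ n)\<^sup>2"
          using assms by (metis d_def power2_abs abs_divide one_power2 power_divide)
        then have "d\<^sup>2 * (K * \<rho> ^ (2 * n)) = 1 / K"
          using K \<rho> by (simp add: power_mult_distrib power_even_eq power2_eq_square)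
        then show "d\<^sup>2 * (K * \<rho> ^ (2 * n)) \<le> 1"
          using K by simp
      qed measurable
    qed
    finally show "(\<integral>\<^sup>+v. F (merge J I (u, v)) \<partial>PiM I (\<lambda>_. D)) \<le> 1" .
  qed
  also have "\<dots> = 1"
  proof -
    interpret J: prob_space "PiM J (\<lambda>_::nat list. D)"
      by (intro prob_space_PiM D.prob_space_axioms)
    show ?thesis by (simp add: J.emeasure_space_1)
  qed
  finally show ?thesis by (simp add: F_def d_def)
qed

lemma prob_large_increment_le:
  assumes "\<bar>c\<bar> = 1"
  shows "law.prob {\<theta> \<in> space law. s \<le> c / (K * \<rho> ^ n) * (level_density (Suc n) \<theta> x - level_density n \<theta> x) - level_density n \<theta> x} \<le> exp (- s)"
proof -
  let ?Z = "\<lambda>\<theta>. c / (K * \<rho> ^ n) * (level_density (Suc n) \<theta> x - level_density n \<theta> x) - level_density n \<theta> x"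
  have [measurable]: "(\<lambda>\<theta>. level_density k \<theta> x) \<in> borel_measurable law" for k
    unfolding perturbation_law_def by (rule level_density_measurable)
  have "emeasure law {\<theta> \<in> space law. s \<le> ?Z \<theta>}
      = emeasure law ({\<theta> \<in> space law. 1 \<le> ennreal (exp (- s)) * ennreal (exp (?Z \<theta>))} \<inter> space law)"
    by (intro arg_cong[of _ _ "emeasure law"])
       (auto simp: ennreal_mult''[symmetric] exp_add[symmetric] simp del: ennreal_1 simp flip: ennreal_1)
  also have "\<dots> \<le> ennreal (exp (- s)) * (\<integral>\<^sup>+\<theta>. ennreal (exp (?Z \<theta>)) * indicator (space law) \<theta> \<partial>law)"
    by (rule order_trans[OF _ nn_integral_Markov_inequality]) (auto intro!: emeasure_mono)
  also have "(\<integral>\<^sup>+\<theta>. ennreal (exp (?Z \<theta>)) * indicator (space law) \<theta> \<partial>law) = (\<integral>\<^sup>+\<theta>. ennreal (exp (?Z \<theta>)) \<partial>law)"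
    by (intro nn_integral_cong) auto
  also have "ennreal (exp (- s)) * (\<integral>\<^sup>+\<theta>. ennreal (exp (?Z \<theta>)) \<partial>law) \<le> ennreal (exp (- s)) * 1"
    by (intro mult_left_mono nn_integral_increment_le_one assms) auto
  finally show ?thesis
    by (simp add: law.emeasure_eq_measure)
qed

text \<open>
  Level \<open>n\<close> of the grid has of the order of \<open>(1 / \<delta>) ^ n\<close> points, while a deviation by \<open>a * Suc n\<close> in the
  normalised scale has probability at most \<open>exp (- a * Suc n)\<close>. A large \<open>a\<close> wins, and the Borel-Cantelli
  lemma applies.
\<close>

lemma AE_increment_on_grid:
  assumes "0 \<le> R" "0 < \<delta>" "\<delta> < 1"
  obtains A where "0 \<le> A" "AE \<theta> in law. \<forall>\<^sub>F n in sequentially. \<forall>k::nat. real k * \<delta> ^ n \<le> 2 * R \<longrightarrow>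
    \<bar>level_density (Suc n) \<theta> (-R + real k * \<delta> ^ n) - level_density n \<theta> (-R + real k * \<delta> ^ n)\<bar>
      \<le> A * \<rho> ^ n * (level_density n \<theta> (-R + real k * \<delta> ^ n) + real (Suc n))"
proof -
  \<comment> \<open>With this rate the union bound is of order \<open>(1 / \<delta>) ^ n * (\<delta> / 2) ^ n\<close>.\<close>
  define a where "a = ln (2 / \<delta>)"
  have a: "0 \<le> a" "exp (- a) = \<delta> / 2" using assms by (auto simp: a_def exp_minus)
  define X where "X n k = -R + real k * \<delta> ^ n" for n k
  define Z where "Z c n k \<theta> = c / (K * \<rho> ^ n) * (level_density (Suc n) \<theta> (X n k) - level_density n \<theta> (X n k))
      - level_density n \<theta> (X n k)" for c n k \<theta>
  define S where "S n = {k::nat. real k * \<delta> ^ n \<le> 2 * R}" for n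
  define B where "B n = (\<Union>k\<in>S n. \<Union>c\<in>{1,-1}. {\<theta> \<in> space law. a * real (Suc n) \<le> Z c n k \<theta>})" for n
  have [measurable]: "(\<lambda>\<theta>. level_density k \<theta> x) \<in> borel_measurable law" for k x
    unfolding perturbation_law_def by (rule level_density_measurable)
  have [measurable]: "Z c n k \<in> borel_measurable law" for c n k
    unfolding Z_def by measurable
  have S_sub: "S n \<subseteq> {..nat \<lfloor>2 * R / \<delta> ^ n\<rfloor>}" for n
    using assms by (auto simp: S_def field_simps le_nat_iff le_floor_iff)
  have S_fin: "finite (S n)" for n
    using S_sub finite_subset by blast
  have S_card: "real (card (S n)) \<le> (2 * R + 1) / \<delta> ^ n" for n
  proof -
    have "card (S n) \<le> Suc (nat \<lfloor>2 * R / \<delta> ^ n\<rfloor>)"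
      using card_mono[OF _ S_sub[of n]] by simp
    then have "real (card (S n)) \<le> 2 * R / \<delta> ^ n + 1"
      using assms of_int_floor_le[of "2 * R / \<delta> ^ n"] by (smt (verit) divide_nonneg_nonneg of_nat_Suc of_nat_floor of_nat_le_iff zero_le_power)
    also have "1 \<le> 1 / \<delta> ^ n"
      using assms by (simp add: power_le_one)
    finally show ?thesis using assms by (simp add: add_divide_distrib)
  qed
  have B_sets[measurable]: "B n \<in> sets law" for n
    unfolding B_def by (intro sets.finite_UN S_fin) measurable
  have B_le: "law.prob (B n) \<le> (2 * R + 1) * \<delta> * (1 / 2) ^ n" for n
  proof -
    have "law.prob (B n) \<le> (\<Sum>k\<in>S n. law.prob (\<Union>c\<in>{1,-1}. {\<theta> \<in> space law. a * real (Suc n) \<le> Z c n k \<theta>}))"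
      unfolding B_def by (intro measure_UNION_le S_fin sets.finite_UN) measurable
    also have "\<dots> \<le> (\<Sum>k\<in>S n. \<Sum>c\<in>{1,-1::real}. law.prob {\<theta> \<in> space law. a * real (Suc n) \<le> Z c n k \<theta>})"
      by (intro sum_mono measure_UNION_le) auto
    also have "\<dots> \<le> (\<Sum>k\<in>S n. \<Sum>c\<in>{1,-1::real}. exp (- (a * real (Suc n))))"
      unfolding Z_def by (intro sum_mono prob_large_increment_le) auto
    also have "\<dots> = real (card (S n)) * (2 * exp (- (a * real (Suc n))))"
      by simp
    also have "exp (- (a * real (Suc n))) = (\<delta> / 2) ^ Suc n"
    proof -
      have "exp (- (a * real (Suc n))) = exp (real (Suc n) * (- a))"
        by simp
      then show ?thesis by (simp only: exp_of_nat_mult a(2))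
    qed
    also have "real (card (S n)) * (2 * (\<delta> / 2) ^ Suc n) \<le> (2 * R + 1) / \<delta> ^ n * (2 * (\<delta> / 2) ^ Suc n)"
      using assms by (intro mult_right_mono S_card) auto
    also have "\<dots> = (2 * R + 1) * \<delta> * (1 / 2) ^ n"
      using assms by (simp add: power_divide field_simps)
    finally show ?thesis .
  qed
  have "AE \<theta> in law. \<forall>\<^sub>F n in sequentially. \<theta> \<in> space law - B n"
  proof (rule borel_cantelli_AE1)
    show "summable (\<lambda>n. law.prob (B n))"
      by (rule summable_comparison_test'[where g = "\<lambda>n. (2 * R + 1) * \<delta> * (1 / 2) ^ n"])
         (use B_le in \<open>auto intro!: summable_mult summable_geometric\<close>)
  qed (auto simp: less_top[symmetric])
  then have "AE \<theta> in law. \<forall>\<^sub>F n in sequentially. \<forall>k::nat. real k * \<delta> ^ n \<le> 2 * R \<longrightarrow>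
    \<bar>level_density (Suc n) \<theta> (X n k) - level_density n \<theta> (X n k)\<bar>
      \<le> K * (1 + a) * \<rho> ^ n * (level_density n \<theta> (X n k) + real (Suc n))"
  proof eventually_elim
    case (elim \<theta>)
    then show ?case
    proof eventually_elim
      case (elim n)
      show ?case
      proof (intro allI impI)
        fix k assume "real k * \<delta> ^ n \<le> 2 * R"
        then have "k \<in> S n" by (simp add: S_def)
        then have less: "Z 1 n k \<theta> < a * real (Suc n)" "Z (-1) n k \<theta> < a * real (Suc n)"
          using elim unfolding B_def by (auto simp: not_le)
        let ?f = "level_density n \<theta> (X n k)" and ?\<Delta> = "level_density (Suc n) \<theta> (X n k) - level_density n \<theta> (X n k)"
        have pos: "0 < K * \<rho> ^ n" using K \<rho> by simp
        have f0: "0 \<le> ?f"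
          unfolding level_density_def by (intro sum_nonneg piece_nonneg words_in_lists)
        have "\<bar>?\<Delta>\<bar> / (K * \<rho> ^ n) \<le> ?f + a * real (Suc n)"
        proof -
          have "\<bar>?\<Delta> / (K * \<rho> ^ n)\<bar> \<le> ?f + a * real (Suc n)"
            using less unfolding Z_def by (simp add: abs_le_iff)
          then show ?thesis using pos by (simp add: abs_divide)
        qed
        also have "\<dots> \<le> (1 + a) * (?f + real (Suc n))"
        proof -
          have "0 \<le> a * ?f" using a f0 by simp
          then show ?thesis by (simp add: algebra_simps)
        qed
        finally show "\<bar>?\<Delta>\<bar> \<le> K * (1 + a) * \<rho> ^ n * (?f + real (Suc n))"
          using pos by (simp add: field_simps)
      qed
    qed
  qed
  moreover have "0 \<le> K * (1 + a)" using K a by simp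
  ultimately show ?thesis
    using that unfolding X_def by blast
qed

end

section \<open>Densities of the pieces of a perturbed self-similar measure\<close>

text \<open>
  \<open>D\<close> is the law of the perturbations and \<open>h\<close> its density; \<open>lmin\<close>, \<open>lmax\<close>, \<open>T\<close> are uniform bounds for the
  contraction ratios and the translations. Along a fixed sequence \<open>\<omega>\<close> the perturbations at its prefixes
  are independent with law \<open>D\<close>, so averages over them can be computed on the sequence space \<open>Q\<close>.
\<close>

locale perturbed_ifs =
  fixes N :: nat and lam t :: "nat \<Rightarrow> real" and lmin lmax T K s' :: real
    and \<mu> :: "(nat \<Rightarrow> nat) measure" and D :: "real measure"
    and h :: "real \<Rightarrow> real" and H L \<gamma> B :: real
  assumes lmin: "0 < lmin" and lmax: "lmax < 1"
    and lam: "\<And>i. i \<in> {1..N} \<Longrightarrow> lmin \<le> lam i" "\<And>i. i \<in> {1..N} \<Longrightarrow> lam i \<le> lmax"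
    and t: "\<And>i. i \<in> {1..N} \<Longrightarrow> \<bar>t i\<bar> \<le> T"
    and nonempty: "1 \<le> N"
    and sets_\<mu>: "sets \<mu> = sets (seq_borel N)"
    and K: "0 < K" and s': "1 < s'"
    and cylinder_le: "\<And>w. w \<in> lists {1..N} \<Longrightarrow>
        emeasure \<mu> (cylinder N w) \<le> ennreal (K * word_ratio lam w powr s')"
    and real_distribution_D: "real_distribution D"
    and D_density: "D = density lborel (\<lambda>x. ennreal (h x))"
    and h_nonneg: "\<And>x. 0 \<le> h x" and h_le: "\<And>x. h x \<le> H"
    and \<gamma>: "0 < \<gamma>" "\<gamma> \<le> 1"
    and h_holder: "\<And>x y. \<bar>h x - h y\<bar> \<le> L * \<bar>x - y\<bar> powr \<gamma>"
    and B: "0 \<le> B" "AE \<xi> in D. \<bar>\<xi>\<bar> \<le> B" "\<And>x. B < \<bar>x\<bar> \<Longrightarrow> h x = 0"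
begin

sublocale D: real_distribution D by (rule real_distribution_D)

abbreviation "Q \<equiv> PiM (UNIV :: nat set) (\<lambda>_. D)"

sublocale Q: prob_space Q by (intro prob_space_PiM D.prob_space_axioms)

lemma space_\<mu>: "space \<mu> = {\<omega>. \<forall>j. \<omega> j \<in> {1..N}}"
proof -
  have "space \<mu> = topspace (seq_topology N)"
    using sets_eq_imp_space_eq[OF sets_\<mu>] by (simp add: seq_borel_def space_measure_of_conv)
  then show ?thesis by (auto simp: seq_topology_def PiE_def Pi_def)
qed

lemma cylinder_eq: "cylinder N w = {\<omega> \<in> space \<mu>. prefix_word (length w) \<omega> = w}"
  unfolding cylinder_def space_\<mu> by (auto simp: seq_topology_def PiE_def Pi_def)

lemma coord_measurable[measurable]: "(\<lambda>\<omega>. \<omega> j) \<in> measurable \<mu> (count_space UNIV)"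
proof (rule measurable_count_space_eq2_countable[THEN iffD2], intro conjI ballI)
  show "(\<lambda>\<omega>. \<omega> j) -` {i} \<inter> space \<mu> \<in> sets \<mu>" for i
  proof (cases "i \<in> {1..N}")
    case True
    have "openin (seq_topology N) {\<omega> \<in> topspace (seq_topology N). \<omega> j \<in> {i}}"
      unfolding seq_topology_def
      by (rule openin_continuous_map_preimage[OF continuous_map_product_projection]) (use True in auto)
    also have "{\<omega> \<in> topspace (seq_topology N). \<omega> j \<in> {i}} = (\<lambda>\<omega>. \<omega> j) -` {i} \<inter> space \<mu>"
      unfolding space_\<mu> by (auto simp: seq_topology_def PiE_def Pi_def)
    finally show ?thesis
      unfolding sets_\<mu> seq_borel_def
      by (subst sets_measure_of) (auto dest: openin_subset)
  next
    case False
    then have "(\<lambda>\<omega>. \<omega> j) -` {i} \<inter> space \<mu> = {}" by (auto simp: space_\<mu>)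
    then show ?thesis by simp
  qed
qed auto

lemma prefix_measurable[measurable]: "prefix_word n \<in> measurable \<mu> (count_space UNIV)"
proof (induction n)
  case 0
  then show ?case by (simp add: prefix_word_def)
next
  case (Suc n)
  have "(\<lambda>\<omega>. (\<lambda>w \<omega>. w @ [\<omega> n]) (prefix_word n \<omega>) \<omega>) \<in> measurable \<mu> (count_space UNIV)"
    by (rule measurable_compose_countable[OF _ Suc]) measurable
  moreover have "prefix_word (Suc n) = (\<lambda>\<omega>. prefix_word n \<omega> @ [\<omega> n])"
    by (simp add: prefix_word_def fun_eq_iff)
  ultimately show ?case by simp
qed

definition prefix_ratio :: "nat \<Rightarrow> (nat \<Rightarrow> nat) \<Rightarrow> real" where
  "prefix_ratio n \<omega> = word_ratio lam (prefix_word n \<omega>)"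

lemma prefix_ratio_measurable[measurable]: "prefix_ratio n \<in> borel_measurable \<mu>"
  unfolding prefix_ratio_def by measurable

lemma prefix_ratio_Suc: "prefix_ratio (Suc n) \<omega> = prefix_ratio n \<omega> * lam (\<omega> n)"
  by (simp add: prefix_ratio_def word_ratio_def prefix_word_def)

lemma prefix_in_lists: "\<omega> \<in> space \<mu> \<Longrightarrow> prefix_word n \<omega> \<in> lists {1..N}"
  by (auto simp: space_\<mu> prefix_word_def)

lemma length_prefix[simp]: "length (prefix_word n \<omega>) = n"
  by (simp add: prefix_word_def)

lemma word_ratio_bounds:
  assumes "w \<in> lists {1..N}"
  shows "lmin ^ length w \<le> word_ratio lam w" "word_ratio lam w \<le> lmax ^ length w"
    "0 < word_ratio lam w" "word_ratio lam w \<le> 1"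
proof -
  have 1: "lmin ^ length w \<le> word_ratio lam w \<and> word_ratio lam w \<le> lmax ^ length w"
    using assms
  proof (induction w)
    case (Cons i w)
    then have i: "lmin \<le> lam i" "lam i \<le> lmax" using lam by auto
    have IH: "lmin ^ length w \<le> prod_list (map lam w)" "prod_list (map lam w) \<le> lmax ^ length w"
      using Cons by (auto simp: word_ratio_def)
    have "0 \<le> prod_list (map lam w)"
      using IH(1) lmin by (meson order_trans zero_le_power less_imp_le)
    then show ?case using i IH lmin
      by (auto simp: word_ratio_def intro!: mult_mono)
  qed (simp add: word_ratio_def)
  then show "lmin ^ length w \<le> word_ratio lam w" "word_ratio lam w \<le> lmax ^ length w" by auto
  show "0 < word_ratio lam w"
    using 1 lmin by (meson less_le_trans zero_less_power)
  have "lmin \<le> lmax" using lam[of 1] nonempty by auto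
  then have "lmax ^ length w \<le> 1" using lmin lmax by (intro power_le_one) auto
  then show "word_ratio lam w \<le> 1" using 1 by simp
qed

lemma lmax_pos: "0 < lmax"
  using lam[of 1] nonempty lmin by auto

lemma prefix_ratio_bounds:
  assumes "\<omega> \<in> space \<mu>"
  shows "lmin ^ n \<le> prefix_ratio n \<omega>" "prefix_ratio n \<omega> \<le> lmax ^ n" "0 < prefix_ratio n \<omega>" "prefix_ratio n \<omega> \<le> 1"
  using word_ratio_bounds[OF prefix_in_lists[OF assms, of n]] by (simp_all add: prefix_ratio_def)

lemma cylinder_measurable[measurable]: "cylinder N w \<in> sets \<mu>"
  unfolding cylinder_eq by measurable

sublocale \<mu>: finite_measure \<mu>
proof
  have "emeasure \<mu> (cylinder N []) \<le> ennreal (K * word_ratio lam [] powr s')"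
    by (rule cylinder_le) simp
  then show "emeasure \<mu> (space \<mu>) \<noteq> \<infinity>"
    by (auto simp: cylinder_eq prefix_word_def top_unique)
qed

lemma measure_cylinder_le:
  assumes "w \<in> lists {1..N}"
  shows "measure \<mu> (cylinder N w) \<le> K * word_ratio lam w powr s'"
  using cylinder_le[OF assms] K by (simp add: \<mu>.emeasure_eq_measure ennreal_le_iff)

text \<open>
  All series along a sequence are dominated by a geometric one; the starting index \<open>n\<close> gives the
  exponentially small bounds for tails.
\<close>

lemma prefix_ratio_series:
  fixes x :: "nat \<Rightarrow> real"
  assumes "\<omega> \<in> space \<mu>" "\<And>k. \<bar>x k\<bar> \<le> c"
  shows "summable (\<lambda>k. prefix_ratio (n + k) \<omega> * x k)"
    and "\<bar>\<Sum>k. prefix_ratio (n + k) \<omega> * x k\<bar> \<le> lmax ^ n * c / (1 - lmax)"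
proof -
  have c: "0 \<le> c" using assms(2)[of 0] by linarith
  have le: "norm (prefix_ratio (n + k) \<omega> * x k) \<le> lmax ^ n * c * lmax ^ k" for k
  proof -
    have "norm (prefix_ratio (n + k) \<omega> * x k) = prefix_ratio (n + k) \<omega> * \<bar>x k\<bar>"
      using prefix_ratio_bounds(3)[OF assms(1), of "n + k"] by (simp add: abs_mult)
    also have "\<dots> \<le> lmax ^ (n + k) * c"
      using prefix_ratio_bounds[OF assms(1), of "n + k"] lmax_pos assms(2)[of k] by (intro mult_mono) auto
    finally show ?thesis by (simp add: power_add mult_ac)
  qed
  have sums: "(\<lambda>k. lmax ^ n * c * lmax ^ k) sums (lmax ^ n * c * (1 / (1 - lmax)))"
    using lmax lmax_pos by (intro sums_mult geometric_sums) auto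
  show sm: "summable (\<lambda>k. prefix_ratio (n + k) \<omega> * x k)"
    by (rule summable_comparison_test'[OF sums_summable[OF sums]]) (rule le)
  have "norm (\<Sum>k. prefix_ratio (n + k) \<omega> * x k) \<le> (\<Sum>k. lmax ^ n * c * lmax ^ k)"
    by (rule norm_suminf_le[OF le sums_summable[OF sums]])
  then show "\<bar>\<Sum>k. prefix_ratio (n + k) \<omega> * x k\<bar> \<le> lmax ^ n * c / (1 - lmax)"
    using sums_unique[OF sums] by simp
qed

definition unperturbed :: "(nat \<Rightarrow> nat) \<Rightarrow> real" where
  "unperturbed \<omega> = (\<Sum>j. prefix_ratio j \<omega> * t (\<omega> j))"

text \<open>
  The perturbations strictly below level \<open>n\<close>. Level \<open>n\<close> itself is left out, since its perturbation supplies
  the density in \<open>path_kernel\<close>.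
\<close>

definition tail_sum :: "nat \<Rightarrow> (nat \<Rightarrow> nat) \<Rightarrow> (nat \<Rightarrow> real) \<Rightarrow> real" where
  "tail_sum n \<omega> X = (\<Sum>k. prefix_ratio (Suc n + k) \<omega> * X k)"

lemma unperturbed_measurable[measurable]: "unperturbed \<in> borel_measurable \<mu>"
  unfolding unperturbed_def by measurable

lemma component_measurable[measurable]: "(\<lambda>X. X k) \<in> borel_measurable Q"
  using measurable_component_singleton[of k UNIV "\<lambda>_. D"]
    measurable_cong_sets[OF refl D.events_eq_borel] by blast

lemma tail_sum_measurable[measurable (raw)]:
  assumes [measurable]: "f \<in> measurable M \<mu>" "g \<in> measurable M Q"
  shows "(\<lambda>z. tail_sum n (f z) (g z)) \<in> borel_measurable M"
  unfolding tail_sum_def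
proof (intro borel_measurable_suminf borel_measurable_times)
  show "(\<lambda>z. g z k) \<in> borel_measurable M" for k
    by (rule measurable_compose[OF assms(2) component_measurable])
qed measurable

lemma AE_Q_bounded: "AE X in Q. \<forall>k. \<bar>X k\<bar> \<le> B"
  unfolding AE_all_countable
  by (intro allI AE_PiM_component D.prob_space_axioms B) auto

lemma tail_sum_case_nat:
  assumes "\<omega> \<in> space \<mu>" "\<And>k. \<bar>X k\<bar> \<le> c"
  shows "tail_sum n \<omega> (case_nat \<xi> X) = prefix_ratio (Suc n) \<omega> * \<xi> + tail_sum (Suc n) \<omega> X"
proof -
  have "summable (\<lambda>k. prefix_ratio (Suc n + Suc k) \<omega> * X k)"
    using prefix_ratio_series(1)[OF assms, of "Suc (Suc n)"] by simp
  then have "summable (\<lambda>k. prefix_ratio (Suc n + k) \<omega> * case_nat \<xi> X k)"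
    by (subst summable_Suc_iff[symmetric]) simp
  from suminf_split_head[OF this] show ?thesis
    by (simp add: tail_sum_def)
qed

lemma h_measurable[measurable]: "h \<in> borel_measurable borel"
  by (rule borel_measurable_continuous_onI, rule continuous_on_of_holder_bound[OF \<gamma>(1)])
     (use h_holder in auto)

lemma L_nonneg: "0 \<le> L"
  using h_holder[of 0 1] by simp

lemma H_nonneg: "0 \<le> H"
  using h_nonneg[of 0] h_le[of 0] by linarith

text \<open>
  The density at \<open>y\<close> of \<open>unperturbed \<omega> + prefix_ratio n \<omega> * \<xi> + tail_sum n \<omega> X\<close> when \<open>\<xi>\<close> has law \<open>D\<close> and \<open>X\<close>
  is fixed.
\<close>

definition path_kernel :: "nat \<Rightarrow> (nat \<Rightarrow> nat) \<Rightarrow> real \<Rightarrow> (nat \<Rightarrow> real) \<Rightarrow> real" where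
  "path_kernel n \<omega> y X = h ((y - unperturbed \<omega> - tail_sum n \<omega> X) / prefix_ratio n \<omega>) / prefix_ratio n \<omega>"

definition path_density :: "nat \<Rightarrow> (nat \<Rightarrow> nat) \<Rightarrow> real \<Rightarrow> real" where
  "path_density n \<omega> y = (LINT X|Q. path_kernel n \<omega> y X)"

lemma path_kernel_measurable[measurable (raw)]:
  assumes [measurable]: "f \<in> measurable M \<mu>" "u \<in> borel_measurable M" "g \<in> measurable M Q"
  shows "(\<lambda>z. path_kernel n (f z) (u z) (g z)) \<in> borel_measurable M"
  unfolding path_kernel_def by measurable

lemma path_density_measurable[measurable (raw)]:
  assumes [measurable]: "f \<in> measurable M \<mu>" "u \<in> borel_measurable M"
  shows "(\<lambda>z. path_density n (f z) (u z)) \<in> borel_measurable M"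
  unfolding path_density_def by measurable

lemma path_kernel_bounds:
  assumes "\<omega> \<in> space \<mu>"
  shows "0 \<le> path_kernel n \<omega> y X" "path_kernel n \<omega> y X \<le> H / prefix_ratio n \<omega>"
  using prefix_ratio_bounds(3)[OF assms, of n] h_nonneg h_le by (auto simp: path_kernel_def divide_right_mono)

lemma path_kernel_integrable: "\<omega> \<in> space \<mu> \<Longrightarrow> integrable Q (path_kernel n \<omega> y)"
  by (rule Q.integrable_const_bound[of _ "H / prefix_ratio n \<omega>"]) (auto simp: path_kernel_bounds)

lemma path_density_nonneg: "\<omega> \<in> space \<mu> \<Longrightarrow> 0 \<le> path_density n \<omega> y"
  unfolding path_density_def by (intro Bochner_Integration.integral_nonneg path_kernel_bounds)

lemma path_density_le: "\<omega> \<in> space \<mu> \<Longrightarrow> path_density n \<omega> y \<le> H / prefix_ratio n \<omega>"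
  unfolding path_density_def by (intro Q.integral_le_const path_kernel_integrable) (auto simp: path_kernel_bounds)

lemma nn_integral_path_kernel: "\<omega> \<in> space \<mu> \<Longrightarrow> (\<integral>\<^sup>+X. ennreal (path_kernel n \<omega> y X) \<partial>Q) = ennreal (path_density n \<omega> y)"
  unfolding path_density_def by (intro nn_integral_eq_integral path_kernel_integrable) (auto simp: path_kernel_bounds)

lemma path_density_holder:
  assumes "\<omega> \<in> space \<mu>"
  shows "\<bar>path_density n \<omega> y - path_density n \<omega> z\<bar> \<le> L / prefix_ratio n \<omega> powr (1 + \<gamma>) * \<bar>y - z\<bar> powr \<gamma>"
proof -
  let ?r = "prefix_ratio n \<omega>"
  have r: "0 < ?r" by (rule prefix_ratio_bounds[OF assms])
  have pt: "\<bar>path_kernel n \<omega> y X - path_kernel n \<omega> z X\<bar> \<le> L / ?r powr (1 + \<gamma>) * \<bar>y - z\<bar> powr \<gamma>" for X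
  proof -
    let ?u = "(y - unperturbed \<omega> - tail_sum n \<omega> X) / ?r" and ?v = "(z - unperturbed \<omega> - tail_sum n \<omega> X) / ?r"
    have "\<bar>path_kernel n \<omega> y X - path_kernel n \<omega> z X\<bar> = \<bar>h ?u - h ?v\<bar> / ?r"
      using r by (simp add: path_kernel_def diff_divide_distrib[symmetric] abs_divide)
    also have "\<dots> \<le> L * \<bar>?u - ?v\<bar> powr \<gamma> / ?r"
      using r by (intro divide_right_mono h_holder) auto
    also have "?u - ?v = (y - z) / ?r" by (simp add: diff_divide_distrib[symmetric])
    also have "\<bar>(y - z) / ?r\<bar> powr \<gamma> = \<bar>y - z\<bar> powr \<gamma> / ?r powr \<gamma>"
      using r by (simp add: abs_divide powr_divide)
    also have "L * (\<bar>y - z\<bar> powr \<gamma> / ?r powr \<gamma>) / ?r = L / ?r powr (1 + \<gamma>) * \<bar>y - z\<bar> powr \<gamma>"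
      using r by (simp add: powr_add field_simps)
    finally show ?thesis .
  qed
  have "\<bar>path_density n \<omega> y - path_density n \<omega> z\<bar> = \<bar>LINT X|Q. path_kernel n \<omega> y X - path_kernel n \<omega> z X\<bar>"
    unfolding path_density_def using assms by (simp add: path_kernel_integrable)
  also have "\<dots> \<le> (LINT X|Q. \<bar>path_kernel n \<omega> y X - path_kernel n \<omega> z X\<bar>)"
    by (rule integral_abs_bound)
  also have "\<dots> \<le> L / ?r powr (1 + \<gamma>) * \<bar>y - z\<bar> powr \<gamma>"
    using assms pt by (intro Q.integral_le_const) (auto intro!: integrable_abs Bochner_Integration.integrable_diff path_kernel_integrable)
  finally show ?thesis .
qed

definition radius :: real where "radius = (T + B) / (1 - lmax) + B"

lemma T_nonneg: "0 \<le> T"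
  using t[of 1] nonempty by auto

lemma path_density_eq_0:
  assumes "\<omega> \<in> space \<mu>" "radius < \<bar>y\<bar>"
  shows "path_density n \<omega> y = 0"
proof -
  have "AE X in Q. path_kernel n \<omega> y X = 0"
    using AE_Q_bounded
  proof eventually_elim
    case (elim X)
    have "\<bar>unperturbed \<omega>\<bar> \<le> lmax ^ 0 * T / (1 - lmax)"
      using prefix_ratio_series(2)[OF assms(1), of "\<lambda>j. t (\<omega> j)" T 0] assms t
      by (auto simp: unperturbed_def space_\<mu>)
    then have b: "\<bar>unperturbed \<omega>\<bar> \<le> T / (1 - lmax)" by simp
    have "\<bar>tail_sum n \<omega> X\<bar> \<le> lmax ^ Suc n * B / (1 - lmax)"
      unfolding tail_sum_def using elim by (intro prefix_ratio_series assms) auto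
    also have "\<dots> \<le> 1 * B / (1 - lmax)"
      using lmax lmax_pos B by (intro divide_right_mono mult_right_mono power_le_one) auto
    finally have tl: "\<bar>tail_sum n \<omega> X\<bar> \<le> B / (1 - lmax)" by simp
    have r: "0 < prefix_ratio n \<omega>" "prefix_ratio n \<omega> \<le> 1" using prefix_ratio_bounds[OF assms(1)] by auto
    have "B < \<bar>y - unperturbed \<omega> - tail_sum n \<omega> X\<bar>"
      using assms(2) b tl unfolding radius_def add_divide_distrib by linarith
    also have "\<dots> \<le> \<bar>y - unperturbed \<omega> - tail_sum n \<omega> X\<bar> / prefix_ratio n \<omega>"
      using r by (simp add: pos_le_divide_eq mult_left_le del: diff_diff_eq)
    also have "\<dots> = \<bar>(y - unperturbed \<omega> - tail_sum n \<omega> X) / prefix_ratio n \<omega>\<bar>"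
      using r by (simp add: abs_divide)
    finally show "path_kernel n \<omega> y X = 0" by (simp add: path_kernel_def B)
  qed
  then show ?thesis unfolding path_density_def by (simp add: integral_eq_zero_AE)
qed

text \<open>
  Both sides are the density at \<open>u\<close> of \<open>r * \<xi> + r' * \<xi>'\<close> for independent \<open>\<xi>\<close> and \<open>\<xi>'\<close> with law \<open>D\<close>,
  computed by smoothing with the density of either summand.
\<close>

lemma scaled_convolution_commute:
  assumes "0 < r" "0 < r'"
  shows "(LINT \<xi>|D. h ((u - r * \<xi>) / r') / r') = (LINT \<xi>|D. h ((u - r' * \<xi>) / r) / r)"
proof -
  have "(LINT \<xi>|D. h ((u - r * \<xi>) / r') / r') = (LBINT x. h x * (h ((u - r * x) / r') / r'))"
    unfolding D_density by (subst integral_density) (auto simp: h_nonneg)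
  also have "\<dots> = \<bar>- (r' / r)\<bar> *\<^sub>R (LBINT x. h (u / r + - (r' / r) * x) * (h ((u - r * (u / r + - (r' / r) * x)) / r') / r'))"
    by (rule lborel_integral_real_affine) (use assms in auto)
  also have "\<dots> = (LBINT x. h x * (h ((u - r' * x) / r) / r))"
  proof -
    have "(u - r * (u / r + - (r' / r) * x)) / r' = x" "u / r + - (r' / r) * x = (u - r' * x) / r" for x
      using assms by (auto simp: field_simps)
    then have "(LBINT x. h (u / r + - (r' / r) * x) * (h ((u - r * (u / r + - (r' / r) * x)) / r') / r'))
       = (LBINT x. (h x * (h ((u - r' * x) / r) / r)) * (r / r'))"
      using assms by (intro Bochner_Integration.integral_cong) (auto simp: field_simps)
    then show ?thesis using assms by simp
  qed
  also have "\<dots> = (LINT \<xi>|D. h ((u - r' * \<xi>) / r) / r)"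
    unfolding D_density by (subst integral_density) (auto simp: h_nonneg)
  finally show ?thesis .
qed

text \<open>
  Both sides compute the density of the sum of all contributions along \<open>\<omega>\<close> from level \<open>n\<close> on. The left side
  takes the density from the perturbation at level \<open>n + 1\<close>, the right side from the one at level \<open>n\<close>. The shift invariance of \<open>Q\<close> splits off the
  coordinate that has to be exchanged.
\<close>

lemma path_density_mean:
  assumes \<omega>: "\<omega> \<in> space \<mu>"
  shows "(LINT \<xi>|D. path_density (Suc n) \<omega> (y - prefix_ratio n \<omega> * \<xi>)) = path_density n \<omega> y"
proof -
  let ?r = "prefix_ratio n \<omega>" and ?r' = "prefix_ratio (Suc n) \<omega>"
  have r: "0 < ?r" "0 < ?r'" by (rule prefix_ratio_bounds[OF \<omega>])+
  interpret DQ: pair_prob_space D Q ..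
  interpret seq: sequence_space D ..
  \<comment> \<open>What remains of \<open>y\<close> once everything except the perturbations at levels \<open>n\<close> and \<open>n + 1\<close> is removed.\<close>
  define u where "u X = y - unperturbed \<omega> - tail_sum (Suc n) \<omega> X" for X
  have u_meas[measurable]: "u \<in> borel_measurable Q"
    unfolding u_def using \<omega> by measurable
  have "(LINT \<xi>|D. path_density (Suc n) \<omega> (y - ?r * \<xi>)) = (LINT \<xi>|D. LINT X|Q. h ((u X - ?r * \<xi>) / ?r') / ?r')"
    unfolding path_density_def path_kernel_def u_def by (simp add: algebra_simps)
  also have "\<dots> = (LINT X|Q. LINT \<xi>|D. h ((u X - ?r * \<xi>) / ?r') / ?r')"
  proof (rule DQ.Fubini_integral[symmetric])
    show "integrable (D \<Otimes>\<^sub>M Q) (\<lambda>(\<xi>, X). h ((u X - ?r * \<xi>) / ?r') / ?r')"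
      by (rule DQ.integrable_const_bound[of _ "H / ?r'"])
        (use r h_nonneg h_le in \<open>auto simp: divide_right_mono\<close>)
  qed
  also have "\<dots> = (LINT X|Q. LINT \<xi>|D. h ((u X - ?r' * \<xi>) / ?r) / ?r)"
    by (intro Bochner_Integration.integral_cong refl scaled_convolution_commute r)
  also have "\<dots> = (LINT \<xi>|D. LINT X|Q. h ((u X - ?r' * \<xi>) / ?r) / ?r)"
  proof (rule DQ.Fubini_integral)
    show "integrable (D \<Otimes>\<^sub>M Q) (\<lambda>(\<xi>, X). h ((u X - ?r' * \<xi>) / ?r) / ?r)"
      by (rule DQ.integrable_const_bound[of _ "H / ?r"])
        (use r h_nonneg h_le in \<open>auto simp: divide_right_mono\<close>)
  qed
  also have "\<dots> = (LINT \<xi>|D. LINT X|Q. path_kernel n \<omega> y (case_nat \<xi> X))"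
  proof (rule Bochner_Integration.integral_cong[OF refl], rule integral_cong_AE)
    fix \<xi>
    show "AE X in Q. h ((u X - ?r' * \<xi>) / ?r) / ?r = path_kernel n \<omega> y (case_nat \<xi> X)"
      using AE_Q_bounded
      by eventually_elim (simp add: path_kernel_def u_def tail_sum_case_nat[OF \<omega>, of _ B] algebra_simps)
    have "case_nat \<xi> \<in> measurable Q Q" by measurable
    then show "(\<lambda>X. path_kernel n \<omega> y (case_nat \<xi> X)) \<in> borel_measurable Q"
      by (intro path_kernel_measurable) (use \<omega> in auto)
  qed measurable
  also have "\<dots> = (LINT z|(D \<Otimes>\<^sub>M Q). path_kernel n \<omega> y (case z of (\<xi>, X) \<Rightarrow> case_nat \<xi> X))"
  proof -
    have "(\<lambda>z. path_kernel n \<omega> y (case z of (\<xi>, X) \<Rightarrow> case_nat \<xi> X)) \<in> borel_measurable (D \<Otimes>\<^sub>M Q)"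
      by (rule path_kernel_measurable) (use \<omega> in measurable)
    then have "integrable (D \<Otimes>\<^sub>M Q) (\<lambda>z. path_kernel n \<omega> y (case z of (\<xi>, X) \<Rightarrow> case_nat \<xi> X))"
      by (intro DQ.integrable_const_bound[of _ "H / ?r"]) (auto simp: path_kernel_bounds[OF \<omega>])
    from DQ.integral_fst'[OF this] show ?thesis by simp
  qed
  also have "\<dots> = (LINT X|distr (D \<Otimes>\<^sub>M Q) Q (\<lambda>(\<xi>, X). case_nat \<xi> X). path_kernel n \<omega> y X)"
    by (rule integral_distr[symmetric]) (use \<omega> in measurable)
  also have "\<dots> = path_density n \<omega> y"
    by (simp add: seq.PiM_iter path_density_def)
  finally show ?thesis .
qed

text \<open>
  The density of the part of the random measure carried by the cylinder of \<open>w\<close>, averaged over the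
  perturbations at \<open>w\<close> and at its descendants, and before translation by \<open>word_shift\<close>.
\<close>

definition cylinder_density :: "nat list \<Rightarrow> real \<Rightarrow> real" where
  "cylinder_density w y = (LINT \<omega>|\<mu>. indicator (cylinder N w) \<omega> * path_density (length w) \<omega> y)"

lemma cylinderD:
  assumes "\<omega> \<in> cylinder N w"
  shows "\<omega> \<in> space \<mu>" "prefix_word (length w) \<omega> = w" "prefix_ratio (length w) \<omega> = word_ratio lam w" "w \<in> lists {1..N}"
  using assms prefix_in_lists[of \<omega> "length w"] by (auto simp: cylinder_eq prefix_ratio_def)

lemma sum_cylinder_children:
  assumes "\<omega> \<in> space \<mu>"
  shows "(\<Sum>i=1..N. indicator (cylinder N (w @ [i])) \<omega>) = (indicator (cylinder N w) \<omega> :: real)"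
proof -
  have "indicator (cylinder N (w @ [i])) \<omega> = (if i = \<omega> (length w) then indicator (cylinder N w) \<omega> else 0 :: real)" for i
    using assms by (auto simp: indicator_def cylinder_eq prefix_word_def)
  then show ?thesis using assms by (simp add: space_\<mu>)
qed

lemma cylinder_path_density_integrable:
  "integrable \<mu> (\<lambda>\<omega>. indicator (cylinder N w) \<omega> * path_density m \<omega> y)"
proof (rule \<mu>.integrable_const_bound[of _ "H / lmin ^ m"])
  show "AE \<omega> in \<mu>. norm (indicator (cylinder N w) \<omega> * path_density m \<omega> y) \<le> H / lmin ^ m"
  proof (rule AE_I2)
    fix \<omega> assume \<omega>: "\<omega> \<in> space \<mu>"
    have "H / prefix_ratio m \<omega> \<le> H / lmin ^ m"
      using prefix_ratio_bounds[OF \<omega>, of m] lmin H_nonneg by (intro divide_left_mono) auto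
    then show "norm (indicator (cylinder N w) \<omega> * path_density m \<omega> y) \<le> H / lmin ^ m"
      using path_density_le[OF \<omega>, of m y] path_density_nonneg[OF \<omega>, of m y] by (auto simp: indicator_def)
  qed
qed measurable

lemma sum_cylinder_density_children:
  "(\<Sum>i=1..N. cylinder_density (w @ [i]) y) = (LINT \<omega>|\<mu>. indicator (cylinder N w) \<omega> * path_density (Suc (length w)) \<omega> y)"
proof -
  have "(\<Sum>i=1..N. cylinder_density (w @ [i]) y)
      = (LINT \<omega>|\<mu>. (\<Sum>i=1..N. indicator (cylinder N (w @ [i])) \<omega> * path_density (Suc (length w)) \<omega> y))"
    unfolding cylinder_density_def by (subst Bochner_Integration.integral_sum) (auto intro: cylinder_path_density_integrable)
  also have "\<dots> = (LINT \<omega>|\<mu>. indicator (cylinder N w) \<omega> * path_density (Suc (length w)) \<omega> y)"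
    by (intro Bochner_Integration.integral_cong refl)
      (simp only: sum_distrib_right[symmetric] sum_cylinder_children)
  finally show ?thesis .
qed

lemma cylinder_integral_le:
  assumes w: "w \<in> lists {1..N}" and int: "integrable \<mu> f"
    and f: "\<And>\<omega>. \<omega> \<in> space \<mu> \<Longrightarrow> f \<omega> \<le> indicator (cylinder N w) \<omega> * (c / word_ratio lam w)" and c: "0 \<le> c"
  shows "(LINT \<omega>|\<mu>. f \<omega>) \<le> c * K * word_ratio lam w powr (s' - 1)"
proof -
  let ?r = "word_ratio lam w"
  have r: "0 < ?r" by (rule word_ratio_bounds[OF w])
  have "(LINT \<omega>|\<mu>. f \<omega>) \<le> (LINT \<omega>|\<mu>. indicator (cylinder N w) \<omega> * (c / ?r))"
    by (intro integral_mono int f integrable_mult_left) (auto simp: \<mu>.emeasure_finite less_top[symmetric])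
  also have "\<dots> = measure \<mu> (cylinder N w) * (c / ?r)"
    by simp
  also have "\<dots> \<le> K * ?r powr s' * (c / ?r)"
    using r c by (intro mult_right_mono measure_cylinder_le w) auto
  also have "\<dots> = c * K * ?r powr (s' - 1)"
    using r by (simp add: powr_diff)
  finally show ?thesis .
qed

lemma cylinder_density_nonneg: "0 \<le> cylinder_density w y"
  unfolding cylinder_density_def by (intro Bochner_Integration.integral_nonneg) (auto simp: path_density_nonneg)

definition \<rho> :: real where "\<rho> = sqrt (lmax powr (s' - 1))"

lemma \<rho>: "0 < \<rho>" "\<rho> < 1"
  using lmax lmax_pos s' powr_less_mono2[of "s' - 1" lmax 1] by (auto simp: \<rho>_def)

text \<open>
  The smoothing at scale \<open>\<lambda>\<^sub>w\<close> costs a factor \<open>1 / \<lambda>\<^sub>w\<close> and the cylinder has mass at most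
  \<open>K * \<lambda>\<^sub>w powr s'\<close>, which leaves \<open>\<lambda>\<^sub>w powr (s' - 1)\<close>; this is small precisely because \<open>s' > 1\<close>.
\<close>

lemma sum_cylinder_density_children_le:
  assumes w: "w \<in> lists {1..N}"
  shows "(\<Sum>i=1..N. cylinder_density (w @ [i]) y) \<le> max 1 (H * K / lmin) * \<rho> ^ (2 * length w)"
proof -
  let ?r = "word_ratio lam w"
  have r: "0 < ?r" by (rule word_ratio_bounds[OF w])
  have "(\<Sum>i=1..N. cylinder_density (w @ [i]) y) \<le> H / lmin * K * ?r powr (s' - 1)"
    unfolding sum_cylinder_density_children
  proof (rule cylinder_integral_le[OF w cylinder_path_density_integrable])
    fix \<omega> assume \<omega>: "\<omega> \<in> space \<mu>"
    show "indicator (cylinder N w) \<omega> * path_density (Suc (length w)) \<omega> y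
        \<le> indicator (cylinder N w) \<omega> * (H / lmin / ?r)"
    proof (cases "\<omega> \<in> cylinder N w")
      case True
      have "?r * lmin \<le> prefix_ratio (Suc (length w)) \<omega>"
        unfolding prefix_ratio_Suc cylinderD(3)[OF True] using r \<omega> lam by (auto simp: space_\<mu>)
      then have "H / prefix_ratio (Suc (length w)) \<omega> \<le> H / (?r * lmin)"
        using r lmin H_nonneg by (intro divide_left_mono mult_pos_pos prefix_ratio_bounds[OF \<omega>]) auto
      then show ?thesis using path_density_le[OF \<omega>, of "Suc (length w)" y] True by (simp add: mult.commute)
    qed simp
  qed (use H_nonneg lmin in auto)
  moreover have "?r powr (s' - 1) \<le> (lmax ^ length w) powr (s' - 1)"
    using r word_ratio_bounds[OF w] s' by (intro powr_mono2) auto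
  moreover have "(lmax ^ length w) powr (s' - 1) = \<rho> ^ (2 * length w)"
  proof -
    have "(lmax ^ length w) powr (s' - 1) = (lmax powr (s' - 1)) ^ length w"
      using lmax_pos by (simp add: powr_power powr_realpow[symmetric] powr_powr mult.commute)
    then show ?thesis unfolding \<rho>_def power_mult by simp
  qed
  ultimately have "(\<Sum>i=1..N. cylinder_density (w @ [i]) y) \<le> H / lmin * K * \<rho> ^ (2 * length w)"
    using H_nonneg lmin K by (elim order_trans) (intro mult_left_mono, auto)
  also have "\<dots> \<le> max 1 (H * K / lmin) * \<rho> ^ (2 * length w)"
    using \<rho> by (intro mult_right_mono) auto
  finally show ?thesis .
qed

lemma cylinder_density_holder:
  assumes w: "w \<in> lists {1..N}"
  shows "\<bar>cylinder_density w y - cylinder_density w z\<bar> \<le> K * L * (1 / lmin powr (1 + \<gamma>)) ^ length w * \<bar>y - z\<bar> powr \<gamma>"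
proof -
  let ?r = "word_ratio lam w" and ?i = "\<lambda>\<omega>. indicator (cylinder N w) \<omega> :: real"
  let ?c = "L / ?r powr (1 + \<gamma>) * \<bar>y - z\<bar> powr \<gamma>"
  have r: "0 < ?r" "?r \<le> 1" "lmin ^ length w \<le> ?r" by (rule word_ratio_bounds[OF w])+
  have "\<bar>cylinder_density w y - cylinder_density w z\<bar> = \<bar>LINT \<omega>|\<mu>. ?i \<omega> * path_density (length w) \<omega> y - ?i \<omega> * path_density (length w) \<omega> z\<bar>"
    unfolding cylinder_density_def by (simp add: cylinder_path_density_integrable)
  also have "\<dots> \<le> (LINT \<omega>|\<mu>. \<bar>?i \<omega> * path_density (length w) \<omega> y - ?i \<omega> * path_density (length w) \<omega> z\<bar>)"
    by (rule integral_abs_bound)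
  also have "\<dots> \<le> ?c * ?r * K * ?r powr (s' - 1)"
  proof (rule cylinder_integral_le[OF w])
    show "\<bar>?i \<omega> * path_density (length w) \<omega> y - ?i \<omega> * path_density (length w) \<omega> z\<bar> \<le> ?i \<omega> * (?c * ?r / ?r)" for \<omega>
      using path_density_holder[of \<omega> "length w" y z] cylinderD[of \<omega> w] r by (cases "\<omega> \<in> cylinder N w") auto
  qed (use L_nonneg r in \<open>auto intro!: integrable_abs Bochner_Integration.integrable_diff cylinder_path_density_integrable\<close>)
  also have "\<dots> = ?c * K * ?r powr s'"
    using r by (simp add: powr_diff)
  also have "\<dots> \<le> ?c * K * 1"
    using r L_nonneg K s' by (intro mult_left_mono powr_le1) auto
  also have "\<dots> = K * L * (1 / ?r powr (1 + \<gamma>)) * \<bar>y - z\<bar> powr \<gamma>"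
    by simp
  also have "\<dots> \<le> K * L * (1 / lmin powr (1 + \<gamma>)) ^ length w * \<bar>y - z\<bar> powr \<gamma>"
  proof -
    have "(lmin powr (1 + \<gamma>)) ^ length w = (lmin ^ length w) powr (1 + \<gamma>)"
      using lmin by (simp add: powr_power powr_realpow[symmetric] powr_powr mult.commute)
    also have "\<dots> \<le> ?r powr (1 + \<gamma>)"
      using r lmin \<gamma> by (intro powr_mono2) auto
    finally show ?thesis
      using r lmin K L_nonneg unfolding power_one_over
      by (intro mult_right_mono mult_left_mono divide_left_mono) (auto simp: mult_pos_pos)
  qed
  finally show ?thesis .
qed

lemma cylinder_density_eq_0: "radius < \<bar>y\<bar> \<Longrightarrow> cylinder_density w y = 0"
  unfolding cylinder_density_def by (intro integral_eq_zero_AE AE_I2) (simp add: path_density_eq_0)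

lemma cylinder_density_measurable[measurable]: "cylinder_density w \<in> borel_measurable borel"
  unfolding cylinder_density_def by measurable

text \<open>
  Fubini reduces the martingale property to \<open>path_density_mean\<close> for each sequence in the cylinder.
\<close>

lemma sum_cylinder_density_children_mean:
  "(LINT \<xi>|D. (\<Sum>i=1..N. cylinder_density (w @ [i]) (y - word_ratio lam w * \<xi>))) = cylinder_density w y"
proof -
  let ?n = "length w" and ?i = "\<lambda>\<omega>. indicator (cylinder N w) \<omega> :: real"
  interpret D\<mu>: pair_sigma_finite D \<mu> ..
  have "(LINT \<xi>|D. (\<Sum>i=1..N. cylinder_density (w @ [i]) (y - word_ratio lam w * \<xi>)))
      = (LINT \<xi>|D. LINT \<omega>|\<mu>. ?i \<omega> * path_density (Suc ?n) \<omega> (y - word_ratio lam w * \<xi>))"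
    by (simp only: sum_cylinder_density_children)
  also have "\<dots> = (LINT \<omega>|\<mu>. LINT \<xi>|D. ?i \<omega> * path_density (Suc ?n) \<omega> (y - word_ratio lam w * \<xi>))"
  proof (rule D\<mu>.Fubini_integral[symmetric])
    interpret D\<mu>': finite_measure "D \<Otimes>\<^sub>M \<mu>"
      by (rule finite_measure_pair_measure) unfold_locales
    show "integrable (D \<Otimes>\<^sub>M \<mu>) (\<lambda>(\<xi>, \<omega>). ?i \<omega> * path_density (Suc ?n) \<omega> (y - word_ratio lam w * \<xi>))"
    proof (rule D\<mu>'.integrable_const_bound[of _ "H / lmin ^ Suc ?n"])
      show "AE x in D \<Otimes>\<^sub>M \<mu>. norm (case x of (\<xi>, \<omega>) \<Rightarrow>
          ?i \<omega> * path_density (Suc ?n) \<omega> (y - word_ratio lam w * \<xi>)) \<le> H / lmin ^ Suc ?n"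
      proof (rule AE_I2, clarsimp simp: space_pair_measure simp del: power_Suc)
        fix \<xi> \<omega> assume \<omega>: "\<omega> \<in> space \<mu>"
        have "H / prefix_ratio (Suc ?n) \<omega> \<le> H / lmin ^ Suc ?n"
          using prefix_ratio_bounds[OF \<omega>, of "Suc ?n"] lmin H_nonneg by (intro divide_left_mono) auto
        then show "\<bar>?i \<omega> * path_density (Suc ?n) \<omega> (y - word_ratio lam w * \<xi>)\<bar> \<le> H / lmin ^ Suc ?n"
          using path_density_le[OF \<omega>, of "Suc ?n" "y - word_ratio lam w * \<xi>"]
            path_density_nonneg[OF \<omega>, of "Suc ?n" "y - word_ratio lam w * \<xi>"]
          by (auto simp: indicator_def simp del: power_Suc)
      qed
    qed measurable
  qed
  also have "\<dots> = cylinder_density w y"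
    unfolding cylinder_density_def
  proof (intro Bochner_Integration.integral_cong refl)
    fix \<omega> assume "\<omega> \<in> space \<mu>"
    then show "(LINT \<xi>|D. ?i \<omega> * path_density (Suc ?n) \<omega> (y - word_ratio lam w * \<xi>)) = ?i \<omega> * path_density ?n \<omega> y"
      using path_density_mean[of \<omega> ?n y] cylinderD[of \<omega> w] by (cases "\<omega> \<in> cylinder N w") auto
  qed
  finally show ?thesis .
qed

sublocale density_martingale N lam D cylinder_density "max 1 (H * K / lmin)" \<rho>
  by unfold_locales
    (use \<rho> cylinder_density_measurable cylinder_density_nonneg sum_cylinder_density_children_le sum_cylinder_density_children_mean in auto)

end

context perturbed_ifs
begin

lemma card_words: "card (words N n) = N ^ n"
proof -
  have "words N n = {w. set w \<subseteq> {1..N} \<and> length w = n}"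
    by (auto simp: words_def)
  then show ?thesis using card_lists_length_eq[of "{1..N}" n] by simp
qed

text \<open>
  The growth rate of the Hoelder constants of the level densities: there are \<open>N ^ n\<close> words of length \<open>n\<close>,
  and rescaling \<open>h\<close> by \<open>r\<close> multiplies its Hoelder constant by \<open>1 / r powr (1 + \<gamma>)\<close>.
\<close>

definition \<Lambda> :: real where "\<Lambda> = real N / lmin powr (1 + \<gamma>)"

lemma \<Lambda>: "1 \<le> \<Lambda>"
proof -
  have "lmin powr (1 + \<gamma>) \<le> 1"
    using lmin \<gamma> lmax lam[of 1] nonempty by (intro powr_le1) auto
  also have "1 \<le> real N" using nonempty by simp
  finally show ?thesis using lmin by (simp add: \<Lambda>_def)
qed

lemma level_density_nonneg: "0 \<le> level_density n \<theta> x"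
  unfolding level_density_def by (intro sum_nonneg cylinder_density_nonneg)

lemma level_density_holder:
  "\<bar>level_density n \<theta> x - level_density n \<theta> y\<bar> \<le> K * L * \<Lambda> ^ n * \<bar>x - y\<bar> powr \<gamma>"
proof -
  have "\<bar>level_density n \<theta> x - level_density n \<theta> y\<bar>
      \<le> (\<Sum>w\<in>words N n. \<bar>cylinder_density w (x - word_shift lam \<theta> w) - cylinder_density w (y - word_shift lam \<theta> w)\<bar>)"
    unfolding level_density_def sum_subtractf[symmetric] by (rule sum_abs)
  also have "\<dots> \<le> (\<Sum>w\<in>words N n. K * L * (1 / lmin powr (1 + \<gamma>)) ^ n * \<bar>x - y\<bar> powr \<gamma>)"
  proof (rule sum_mono)
    fix w assume w: "w \<in> words N n"
    show "\<bar>cylinder_density w (x - word_shift lam \<theta> w) - cylinder_density w (y - word_shift lam \<theta> w)\<bar>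
        \<le> K * L * (1 / lmin powr (1 + \<gamma>)) ^ n * \<bar>x - y\<bar> powr \<gamma>"
      using cylinder_density_holder[OF words_in_lists[OF w], of "x - word_shift lam \<theta> w" "y - word_shift lam \<theta> w"] w
      by (simp add: words_def)
  qed
  also have "\<dots> = K * L * \<Lambda> ^ n * \<bar>x - y\<bar> powr \<gamma>"
    by (simp add: card_words \<Lambda>_def power_divide)
  finally show ?thesis .
qed

definition support_radius :: real where "support_radius = radius + B / (1 - lmax)"

lemma level_density_eq_0:
  assumes \<theta>: "\<And>w. w \<in> lists {1..N} \<Longrightarrow> \<bar>\<theta> w\<bar> \<le> B" and x: "support_radius < \<bar>x\<bar>"
  shows "level_density n \<theta> x = 0"
  unfolding level_density_def
proof (rule sum.neutral, intro ballI cylinder_density_eq_0)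
  fix w assume w: "w \<in> words N n"
  then have len: "length w = n" and wl: "w \<in> lists {1..N}" by (auto simp: words_def)
  have tk: "take j w \<in> lists {1..N}" for j using wl by (auto dest: in_set_takeD)
  have "\<bar>word_shift lam \<theta> w\<bar> \<le> (\<Sum>j<n. \<bar>word_ratio lam (take j w) * \<theta> (take j w)\<bar>)"
    unfolding word_shift_def len by (rule sum_abs)
  also have "\<dots> \<le> (\<Sum>j<n. lmax ^ j * B)"
  proof (rule sum_mono)
    fix j assume "j \<in> {..<n}"
    then have "word_ratio lam (take j w) \<le> lmax ^ j" "0 < word_ratio lam (take j w)"
      using word_ratio_bounds[OF tk[of j]] len by auto
    then show "\<bar>word_ratio lam (take j w) * \<theta> (take j w)\<bar> \<le> lmax ^ j * B"
      using \<theta>[OF tk[of j]] by (simp add: abs_mult mult_mono')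
  qed
  also have "\<dots> = (\<Sum>j<n. lmax ^ j) * B" by (simp add: sum_distrib_right)
  also have "\<dots> \<le> (\<Sum>j. lmax ^ j) * B"
    using lmax lmax_pos B by (intro mult_right_mono sum_le_suminf) auto
  also have "(\<Sum>j. lmax ^ j) = 1 / (1 - lmax)"
    using lmax lmax_pos by (intro suminf_geometric) auto
  finally show "radius < \<bar>x - word_shift lam \<theta> w\<bar>"
    using x unfolding support_radius_def by simp
qed

lemma AE_bounded: "AE \<theta> in law. \<forall>w\<in>lists {1..N}. \<bar>\<theta> w\<bar> \<le> B"
  unfolding perturbation_law_def
  by (subst AE_ball_countable) (auto intro!: AE_PiM_component D.prob_space_axioms B)

text \<open>
  The mesh \<open>m\<close> is chosen to balance the growth of the Hoelder constants against the decay of the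
  fluctuations: \<open>\<Lambda> * m powr \<gamma> = \<rho>\<close>.
\<close>

lemma AE_holder_limit:
  "AE \<theta> in law. (\<forall>w\<in>lists {1..N}. \<bar>\<theta> w\<bar> \<le> B) \<and> (\<exists>g n0 U. (\<forall>x. (\<lambda>n. level_density n \<theta> x) \<longlonglongrightarrow> g x) \<and>
      (\<forall>x. 0 \<le> g x) \<and> holder_continuous g \<and> (\<forall>n\<ge>n0. \<forall>x. level_density n \<theta> x \<le> U))"
proof -
  define m where "m = (\<rho> / \<Lambda>) powr (1 / \<gamma>)"
  have ratio: "0 < \<rho> / \<Lambda>" "\<rho> / \<Lambda> < 1"
    using \<rho> \<Lambda> by auto
  have m: "0 < m" "m < 1" "m powr \<gamma> = \<rho> / \<Lambda>"
    using ratio \<gamma> powr_less_mono2[of "1 / \<gamma>" "\<rho> / \<Lambda>" 1] \<rho> \<Lambda> by (auto simp: m_def powr_powr)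
  have R: "0 \<le> support_radius"
    using T_nonneg B lmax by (simp add: support_radius_def radius_def)
  obtain A where A: "0 \<le> A" "AE \<theta> in law. \<forall>\<^sub>F n in sequentially. \<forall>k::nat. real k * m ^ n \<le> 2 * support_radius \<longrightarrow>
    \<bar>level_density (Suc n) \<theta> (-support_radius + real k * m ^ n) - level_density n \<theta> (-support_radius + real k * m ^ n)\<bar>
      \<le> A * \<rho> ^ n * (level_density n \<theta> (-support_radius + real k * m ^ n) + real (Suc n))"
    using AE_increment_on_grid[OF R m(1,2)] by blast
  show ?thesis
    using A(2) AE_bounded
  proof eventually_elim
    case (elim \<theta>)
    obtain g n0 U where "\<And>x. (\<lambda>n. level_density n \<theta> x) \<longlonglongrightarrow> g x" "\<And>x. 0 \<le> g x" "holder_continuous g"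
      "\<And>n x. n0 \<le> n \<Longrightarrow> level_density n \<theta> x \<le> U"
    proof (rule holder_limit_of_grid_control[where f = "\<lambda>n. level_density n \<theta>" and R = support_radius
          and L = "K * L" and \<Lambda> = \<Lambda> and \<gamma> = \<gamma> and \<rho> = \<rho> and \<delta> = m and A = A])
      show "level_density n \<theta> x = 0" if "support_radius < \<bar>x\<bar>" for n x
        using elim(2) that by (intro level_density_eq_0) auto
      show "\<Lambda> * m powr \<gamma> \<le> \<rho>" using \<Lambda> by (simp add: m)
    qed (use R m A \<rho> \<Lambda> \<gamma> K L_nonneg level_density_nonneg level_density_holder elim(1) in auto)
    then show ?case using elim(2) by blast
  qed
qed

section \<open>Identification of the limit as the density of the projected measure\<close>

lemma take_prefix: "j \<le> n \<Longrightarrow> take j (prefix_word n \<omega>) = prefix_word j \<omega>"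
  by (simp add: prefix_word_def take_map)

lemma word_shift_prefix:
  "word_shift lam \<theta> (prefix_word n \<omega>) = (\<Sum>j<n. prefix_ratio j \<omega> * \<theta> (prefix_word j \<omega>))"
  unfolding word_shift_def by (intro sum.cong) (auto simp: take_prefix prefix_ratio_def)

lemma word_shift_prefix_measurable[measurable (raw)]:
  assumes [measurable]: "f \<in> measurable M \<mu>"
  shows "(\<lambda>z. word_shift lam \<theta> (prefix_word n (f z))) \<in> borel_measurable M"
proof -
  have "(\<lambda>\<omega>. word_shift lam \<theta> (prefix_word n \<omega>)) \<in> borel_measurable \<mu>"
    by (rule measurable_compose[OF prefix_measurable]) simp
  from measurable_compose[OF assms this] show ?thesis .
qed

lemma random_projection_split:
  assumes \<omega>: "\<omega> \<in> space \<mu>" and \<theta>: "\<And>w. w \<in> lists {1..N} \<Longrightarrow> \<bar>\<theta> w\<bar> \<le> B"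
  shows "random_projection lam t \<theta> \<omega> = unperturbed \<omega> + word_shift lam \<theta> (prefix_word n \<omega>)
      + (\<Sum>k. prefix_ratio (n + k) \<omega> * \<theta> (prefix_word (n + k) \<omega>))"
proof -
  have 1: "summable (\<lambda>j. prefix_ratio j \<omega> * t (\<omega> j))"
    using prefix_ratio_series(1)[OF \<omega>, of "\<lambda>j. t (\<omega> j)" T 0] \<omega> t by (auto simp: space_\<mu>)
  have 2: "summable (\<lambda>j. prefix_ratio j \<omega> * \<theta> (prefix_word j \<omega>))"
    using prefix_ratio_series(1)[OF \<omega>, of "\<lambda>j. \<theta> (prefix_word j \<omega>)" B 0] \<theta>[OF prefix_in_lists[OF \<omega>]] by auto
  have "random_projection lam t \<theta> \<omega> = (\<Sum>j. prefix_ratio j \<omega> * t (\<omega> j) + prefix_ratio j \<omega> * \<theta> (prefix_word j \<omega>))"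
    unfolding random_projection_def prefix_ratio_def[symmetric] by (simp add: distrib_left)
  also have "\<dots> = unperturbed \<omega> + (\<Sum>j. prefix_ratio j \<omega> * \<theta> (prefix_word j \<omega>))"
    unfolding unperturbed_def by (rule suminf_add[OF 1 2, symmetric])
  also have "(\<Sum>j. prefix_ratio j \<omega> * \<theta> (prefix_word j \<omega>)) = word_shift lam \<theta> (prefix_word n \<omega>)
      + (\<Sum>k. prefix_ratio (n + k) \<omega> * \<theta> (prefix_word (n + k) \<omega>))"
    unfolding word_shift_prefix using suminf_split_initial_segment[OF 2, of n] by (simp add: add.commute)
  finally show ?thesis by simp
qed

lemma random_projection_measurable[measurable]: "random_projection lam t \<theta> \<in> borel_measurable \<mu>"
proof -
  have 1: "(\<lambda>\<omega>. \<theta> (prefix_word j \<omega>)) \<in> borel_measurable \<mu>" for j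
    by (rule measurable_compose[OF prefix_measurable]) simp
  have 2: "(\<lambda>\<omega>. t (\<omega> j)) \<in> borel_measurable \<mu>" for j
    by (rule measurable_compose[OF coord_measurable]) simp
  show ?thesis
    unfolding random_projection_def prefix_ratio_def[symmetric]
    by (intro borel_measurable_suminf borel_measurable_times borel_measurable_add 1 2 prefix_ratio_measurable)
qed

text \<open>
  The projection of \<open>\<omega>\<close> when \<open>\<theta>\<close> is kept at the prefixes shorter than \<open>n\<close>, while fresh perturbations are used
  at level \<open>n\<close> (\<open>\<eta>\<close>) and below (\<open>X\<close>).
\<close>

definition resample :: "(nat list \<Rightarrow> real) \<Rightarrow> nat \<Rightarrow> (nat \<Rightarrow> nat) \<Rightarrow> (nat \<Rightarrow> real) \<Rightarrow> real \<Rightarrow> real" where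
  "resample \<theta> n \<omega> X \<eta> = unperturbed \<omega> + word_shift lam \<theta> (prefix_word n \<omega>) + tail_sum n \<omega> X + prefix_ratio n \<omega> * \<eta>"

lemma ennreal_level_density:
  "ennreal (level_density n \<theta> x) = (\<integral>\<^sup>+\<omega>. ennreal (path_density n \<omega> (x - word_shift lam \<theta> (prefix_word n \<omega>))) \<partial>\<mu>)"
proof -
  have "ennreal (level_density n \<theta> x) = (\<Sum>w\<in>words N n. ennreal (cylinder_density w (x - word_shift lam \<theta> w)))"
    unfolding level_density_def by (intro sum_ennreal[symmetric] cylinder_density_nonneg)
  also have "\<dots> = (\<Sum>w\<in>words N n. \<integral>\<^sup>+\<omega>. ennreal (indicator (cylinder N w) \<omega> * path_density (length w) \<omega> (x - word_shift lam \<theta> w)) \<partial>\<mu>)"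
    unfolding cylinder_density_def
    by (intro sum.cong refl nn_integral_eq_integral[symmetric] cylinder_path_density_integrable) (auto simp: path_density_nonneg)
  also have "\<dots> = (\<integral>\<^sup>+\<omega>. (\<Sum>w\<in>words N n. ennreal (indicator (cylinder N w) \<omega> * path_density (length w) \<omega> (x - word_shift lam \<theta> w))) \<partial>\<mu>)"
    by (rule nn_integral_sum[symmetric]) measurable
  also have "\<dots> = (\<integral>\<^sup>+\<omega>. ennreal (path_density n \<omega> (x - word_shift lam \<theta> (prefix_word n \<omega>))) \<partial>\<mu>)"
  proof (rule nn_integral_cong)
    fix \<omega> assume \<omega>: "\<omega> \<in> space \<mu>"
    let ?g = "\<lambda>w. ennreal (indicator (cylinder N w) \<omega> * path_density (length w) \<omega> (x - word_shift lam \<theta> w))"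
    have "(\<Sum>w\<in>words N n. ?g w) = (\<Sum>w\<in>{prefix_word n \<omega>}. ?g w)"
    proof (rule sum.mono_neutral_right)
      show "{prefix_word n \<omega>} \<subseteq> words N n" using prefix_in_lists[OF \<omega>] by (simp add: words_def)
      show "\<forall>w\<in>words N n - {prefix_word n \<omega>}. ?g w = 0"
        by (auto simp: words_def cylinder_eq indicator_def)
    qed simp
    then show "(\<Sum>w\<in>words N n. ?g w) = ennreal (path_density n \<omega> (x - word_shift lam \<theta> (prefix_word n \<omega>)))"
      using \<omega> by (simp add: cylinder_eq)
  qed
  finally show ?thesis .
qed

text \<open>
  The level density is the density of the law of a resampled projection: integrating \<open>h\<close> against the
  Lebesgue measure after an affine change of variables is the same as sampling \<open>\<eta>\<close> from \<open>D\<close>.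
\<close>

lemma nn_integral_level_density:
  assumes [measurable]: "A \<in> sets borel"
  shows "(\<integral>\<^sup>+x. ennreal (level_density n \<theta> x) * indicator A x \<partial>lborel)
    = (\<integral>\<^sup>+\<omega>. \<integral>\<^sup>+X. \<integral>\<^sup>+\<eta>. indicator A (resample \<theta> n \<omega> X \<eta>) \<partial>D \<partial>Q \<partial>\<mu>)"
proof -
  interpret P1: pair_sigma_finite lborel \<mu> ..
  interpret P2: pair_sigma_finite lborel Q ..
  let ?s = "\<lambda>\<omega>. word_shift lam \<theta> (prefix_word n \<omega>)"
  have "(\<integral>\<^sup>+x. ennreal (level_density n \<theta> x) * indicator A x \<partial>lborel)
      = (\<integral>\<^sup>+x. \<integral>\<^sup>+\<omega>. ennreal (path_density n \<omega> (x - ?s \<omega>)) * indicator A x \<partial>\<mu> \<partial>lborel)"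
    unfolding ennreal_level_density by (intro nn_integral_cong nn_integral_multc[symmetric]) measurable
  also have "\<dots> = (\<integral>\<^sup>+\<omega>. \<integral>\<^sup>+x. ennreal (path_density n \<omega> (x - ?s \<omega>)) * indicator A x \<partial>lborel \<partial>\<mu>)"
    by (rule P1.Fubini'[symmetric]) measurable
  also have "\<dots> = (\<integral>\<^sup>+\<omega>. \<integral>\<^sup>+X. \<integral>\<^sup>+\<eta>. indicator A (resample \<theta> n \<omega> X \<eta>) \<partial>D \<partial>Q \<partial>\<mu>)"
  proof (rule nn_integral_cong)
    fix \<omega> assume \<omega>: "\<omega> \<in> space \<mu>"
    have r: "0 < prefix_ratio n \<omega>" by (rule prefix_ratio_bounds[OF \<omega>])
    have "(\<integral>\<^sup>+x. ennreal (path_density n \<omega> (x - ?s \<omega>)) * indicator A x \<partial>lborel)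
        = (\<integral>\<^sup>+x. \<integral>\<^sup>+X. ennreal (path_kernel n \<omega> (x - ?s \<omega>) X) * indicator A x \<partial>Q \<partial>lborel)"
      unfolding nn_integral_path_kernel[OF \<omega>, symmetric]
      by (intro nn_integral_cong nn_integral_multc[symmetric]) (use \<omega> in measurable)
    also have "\<dots> = (\<integral>\<^sup>+X. \<integral>\<^sup>+x. ennreal (path_kernel n \<omega> (x - ?s \<omega>) X) * indicator A x \<partial>lborel \<partial>Q)"
      by (rule P2.Fubini'[symmetric]) (use \<omega> in measurable)
    also have "\<dots> = (\<integral>\<^sup>+X. \<integral>\<^sup>+\<eta>. indicator A (resample \<theta> n \<omega> X \<eta>) \<partial>D \<partial>Q)"
    proof (rule nn_integral_cong)
      fix X assume X: "X \<in> space Q"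
      define c where "c = unperturbed \<omega> + ?s \<omega> + tail_sum n \<omega> X"
      have "(\<integral>\<^sup>+x. ennreal (path_kernel n \<omega> (x - ?s \<omega>) X) * indicator A x \<partial>lborel)
          = (\<integral>\<^sup>+x. ennreal (h ((x - c) / prefix_ratio n \<omega>) / prefix_ratio n \<omega>) * indicator A x \<partial>lborel)"
        unfolding path_kernel_def c_def by (simp add: algebra_simps)
      also have "\<dots> = ennreal \<bar>prefix_ratio n \<omega>\<bar> * (\<integral>\<^sup>+x. ennreal (h ((c + prefix_ratio n \<omega> * x - c) / prefix_ratio n \<omega>) / prefix_ratio n \<omega>) * indicator A (c + prefix_ratio n \<omega> * x) \<partial>lborel)"
        by (rule nn_integral_real_affine) (use r in auto)
      also have "\<dots> = (\<integral>\<^sup>+x. ennreal (h x) * indicator A (c + prefix_ratio n \<omega> * x) \<partial>lborel)"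
      proof -
        have "ennreal (prefix_ratio n \<omega>) * (ennreal (h x / prefix_ratio n \<omega>) * i) = ennreal (h x) * i" for x i
          using r h_nonneg[of x] by (simp add: mult.assoc[symmetric] ennreal_mult'[symmetric])
        then show ?thesis
          using r by (subst nn_integral_cmult[symmetric]) auto
      qed
      also have "\<dots> = (\<integral>\<^sup>+\<eta>. indicator A (resample \<theta> n \<omega> X \<eta>) \<partial>D)"
        unfolding D_density resample_def c_def by (subst nn_integral_density) auto
      finally show "(\<integral>\<^sup>+x. ennreal (path_kernel n \<omega> (x - ?s \<omega>) X) * indicator A x \<partial>lborel)
          = (\<integral>\<^sup>+\<eta>. indicator A (resample \<theta> n \<omega> X \<eta>) \<partial>D)" .
    qed
    finally show "(\<integral>\<^sup>+x. ennreal (path_density n \<omega> (x - ?s \<omega>)) * indicator A x \<partial>lborel)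
        = (\<integral>\<^sup>+X. \<integral>\<^sup>+\<eta>. indicator A (resample \<theta> n \<omega> X \<eta>) \<partial>D \<partial>Q)" .
  qed
  finally show ?thesis .
qed

definition resample_error :: "nat \<Rightarrow> real" where "resample_error n = 3 * B / (1 - lmax) * lmax ^ n"

lemma resample_close:
  assumes \<omega>: "\<omega> \<in> space \<mu>" and \<theta>: "\<And>w. w \<in> lists {1..N} \<Longrightarrow> \<bar>\<theta> w\<bar> \<le> B"
    and X: "\<forall>k. \<bar>X k\<bar> \<le> B" and \<eta>: "\<bar>\<eta>\<bar> \<le> B"
  shows "\<bar>resample \<theta> n \<omega> X \<eta> - random_projection lam t \<theta> \<omega>\<bar> \<le> resample_error n"
proof -
  let ?e = "lmax ^ n * B / (1 - lmax)" and ?s = "\<Sum>k. prefix_ratio (n + k) \<omega> * \<theta> (prefix_word (n + k) \<omega>)"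
  have "\<bar>tail_sum n \<omega> X\<bar> \<le> lmax ^ Suc n * B / (1 - lmax)"
    unfolding tail_sum_def using X by (intro prefix_ratio_series \<omega>) auto
  also have "\<dots> \<le> ?e"
    using lmax lmax_pos B by (intro divide_right_mono mult_right_mono) (auto intro: mult_left_le_one_le)
  finally have 1: "\<bar>tail_sum n \<omega> X\<bar> \<le> ?e" .
  have 2: "\<bar>?s\<bar> \<le> ?e"
    by (intro prefix_ratio_series \<omega> \<theta> prefix_in_lists)
  have "\<bar>prefix_ratio n \<omega> * \<eta>\<bar> \<le> lmax ^ n * B"
    using prefix_ratio_bounds[OF \<omega>, of n] \<eta> by (simp add: abs_mult mult_mono')
  also have "\<dots> \<le> ?e"
    using lmax lmax_pos B by (simp add: pos_le_divide_eq mult_left_le)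
  finally have 3: "\<bar>prefix_ratio n \<omega> * \<eta>\<bar> \<le> ?e" .
  have e: "resample_error n = ?e + ?e + ?e" by (simp add: resample_error_def)
  have d: "resample \<theta> n \<omega> X \<eta> - random_projection lam t \<theta> \<omega> = tail_sum n \<omega> X + prefix_ratio n \<omega> * \<eta> - ?s"
    unfolding resample_def using random_projection_split[OF \<omega>, of \<theta> n] \<theta> by simp
  have "\<bar>a + b - c\<bar> \<le> e + e + e" if "\<bar>a\<bar> \<le> e" "\<bar>b\<bar> \<le> e" "\<bar>c\<bar> \<le> e" for a b c e :: real
    using that by linarith
  from this[OF 1 3 2] show ?thesis unfolding d e .
qed

lemma level_density_cdf_sandwich:
  assumes \<theta>: "\<And>w. w \<in> lists {1..N} \<Longrightarrow> \<bar>\<theta> w\<bar> \<le> B"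
  defines "\<nu> \<equiv> distr \<mu> borel (random_projection lam t \<theta>)"
  shows "(\<integral>\<^sup>+x. ennreal (level_density n \<theta> x) * indicator {..a} x \<partial>lborel) \<le> emeasure \<nu> {..a + resample_error n}" (is ?upper)
    and "emeasure \<nu> {..a - resample_error n} \<le> (\<integral>\<^sup>+x. ennreal (level_density n \<theta> x) * indicator {..a} x \<partial>lborel)" (is ?lower)
proof -
  have \<nu>: "emeasure \<nu> {..b} = (\<integral>\<^sup>+\<omega>. \<integral>\<^sup>+X. \<integral>\<^sup>+\<eta>. indicator {..b} (random_projection lam t \<theta> \<omega>) \<partial>D \<partial>Q \<partial>\<mu>)" for b
  proof -
    have "emeasure \<nu> {..b} = (\<integral>\<^sup>+x. indicator {..b} x \<partial>\<nu>)"
      by (simp add: \<nu>_def)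
    also have "\<dots> = (\<integral>\<^sup>+\<omega>. indicator {..b} (random_projection lam t \<theta> \<omega>) \<partial>\<mu>)"
      unfolding \<nu>_def by (rule nn_integral_distr[OF random_projection_measurable]) simp
    also have "\<dots> = (\<integral>\<^sup>+\<omega>. \<integral>\<^sup>+X. \<integral>\<^sup>+\<eta>. indicator {..b} (random_projection lam t \<theta> \<omega>) \<partial>D \<partial>Q \<partial>\<mu>)"
      by (simp only: nn_integral_const D.emeasure_space_1 Q.emeasure_space_1 mult_1_right)
    finally show ?thesis .
  qed
  have close: "AE X in Q. AE \<eta> in D. \<bar>resample \<theta> n \<omega> X \<eta> - random_projection lam t \<theta> \<omega>\<bar> \<le> resample_error n"
    if \<omega>: "\<omega> \<in> space \<mu>" for \<omega>
    using AE_Q_bounded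
  proof eventually_elim
    fix X :: "nat \<Rightarrow> real" assume X: "\<forall>k. \<bar>X k\<bar> \<le> B"
    show "AE \<eta> in D. \<bar>resample \<theta> n \<omega> X \<eta> - random_projection lam t \<theta> \<omega>\<bar> \<le> resample_error n"
      using B(2) by eventually_elim (intro resample_close \<omega> \<theta> X)
  qed
  show ?upper
    unfolding nn_integral_level_density[OF atMost_borel] \<nu>
  proof (rule nn_integral_mono)
    fix \<omega> assume \<omega>: "\<omega> \<in> space \<mu>"
    have "AE X in Q. (\<integral>\<^sup>+\<eta>. indicator {..a} (resample \<theta> n \<omega> X \<eta>) \<partial>D) \<le> (\<integral>\<^sup>+\<eta>. indicator {..a + resample_error n} (random_projection lam t \<theta> \<omega>) \<partial>D)"
      using close[OF \<omega>]
    proof eventually_elim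
      case (elim X)
      then have "AE \<eta> in D. indicator {..a} (resample \<theta> n \<omega> X \<eta>) \<le> (indicator {..a + resample_error n} (random_projection lam t \<theta> \<omega>) :: ennreal)"
        by eventually_elim (auto simp: indicator_def)
      then show ?case by (rule nn_integral_mono_AE)
    qed
    then show "(\<integral>\<^sup>+X. \<integral>\<^sup>+\<eta>. indicator {..a} (resample \<theta> n \<omega> X \<eta>) \<partial>D \<partial>Q)
      \<le> (\<integral>\<^sup>+X. \<integral>\<^sup>+\<eta>. indicator {..a + resample_error n} (random_projection lam t \<theta> \<omega>) \<partial>D \<partial>Q)"
      by (rule nn_integral_mono_AE)
  qed
  show ?lower
    unfolding nn_integral_level_density[OF atMost_borel] \<nu>
  proof (rule nn_integral_mono)
    fix \<omega> assume \<omega>: "\<omega> \<in> space \<mu>"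
    have "AE X in Q. (\<integral>\<^sup>+\<eta>. indicator {..a - resample_error n} (random_projection lam t \<theta> \<omega>) \<partial>D) \<le> (\<integral>\<^sup>+\<eta>. indicator {..a} (resample \<theta> n \<omega> X \<eta>) \<partial>D)"
      using close[OF \<omega>]
    proof eventually_elim
      case (elim X)
      then have "AE \<eta> in D. indicator {..a - resample_error n} (random_projection lam t \<theta> \<omega>) \<le> (indicator {..a} (resample \<theta> n \<omega> X \<eta>) :: ennreal)"
        by eventually_elim (auto simp: indicator_def)
      then show ?case by (rule nn_integral_mono_AE)
    qed
    then show "(\<integral>\<^sup>+X. \<integral>\<^sup>+\<eta>. indicator {..a - resample_error n} (random_projection lam t \<theta> \<omega>) \<partial>D \<partial>Q)
      \<le> (\<integral>\<^sup>+X. \<integral>\<^sup>+\<eta>. indicator {..a} (resample \<theta> n \<omega> X \<eta>) \<partial>D \<partial>Q)"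
      by (rule nn_integral_mono_AE)
  qed
qed

text \<open>
  The distribution functions of \<open>\<nu>\<close> and of the level densities agree up to shifts of the argument that tend
  to 0. In the limit each of the two distribution functions dominates the other at any smaller argument, and right
  continuity removes the remaining gap.
\<close>

lemma distr_eq_density_limit:
  assumes \<theta>: "\<And>w. w \<in> lists {1..N} \<Longrightarrow> \<bar>\<theta> w\<bar> \<le> B"
    and lim: "\<And>x. (\<lambda>n. level_density n \<theta> x) \<longlonglongrightarrow> g x"
    and bdd: "\<And>n x. n0 \<le> n \<Longrightarrow> level_density n \<theta> x \<le> U"
  shows "distr \<mu> borel (random_projection lam t \<theta>) = density lborel (\<lambda>x. ennreal (g x))"
proof -
  define \<nu> where "\<nu> = distr \<mu> borel (random_projection lam t \<theta>)"
  define G where "G = density lborel (\<lambda>x. ennreal (g x))"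
  define F where "F n a = (\<integral>\<^sup>+x. ennreal (level_density n \<theta> x) * indicator {..a} x \<partial>lborel)" for n a
  have level_density_meas[measurable]: "level_density n \<theta> \<in> borel_measurable borel" for n
    unfolding level_density_def by measurable
  have g_meas[measurable]: "g \<in> borel_measurable borel"
    by (rule borel_measurable_LIMSEQ_real[OF lim]) measurable
  \<comment> \<open>The level densities are eventually bounded and live on one compact interval, so this dominates them.\<close>
  let ?w = "\<lambda>x. ennreal U * indicator {-support_radius..support_radius} x"
  have level_density_le: "ennreal (level_density n \<theta> x) \<le> ?w x" if "n0 \<le> n" for n x
  proof (cases "\<bar>x\<bar> \<le> support_radius")
    case True
    then show ?thesis using bdd[OF that, of x] by (auto simp: indicator_def intro: ennreal_leI)
  next
    case False
    then show ?thesis using level_density_eq_0[OF \<theta>, where x = x and n = n] by simp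
  qed
  have w_fin: "(\<integral>\<^sup>+x. ?w x \<partial>lborel) < \<infinity>"
    by (subst nn_integral_cmult_indicator) (auto simp: emeasure_lborel_Icc_eq ennreal_mult_less_top)
  have F_lim: "(\<lambda>n. F n a) \<longlonglongrightarrow> emeasure G {..a}" for a
  proof -
    have "(\<lambda>n. F (n + n0) a) \<longlonglongrightarrow> (\<integral>\<^sup>+x. ennreal (g x) * indicator {..a} x \<partial>lborel)"
      unfolding F_def
    proof (rule nn_integral_dominated_convergence[where w = ?w])
      show "AE x in lborel. ennreal (level_density (n + n0) \<theta> x) * indicator {..a} x \<le> ?w x" for n
      proof (rule AE_I2)
        fix x
        have "ennreal (level_density (n + n0) \<theta> x) * indicator {..a} x \<le> ennreal (level_density (n + n0) \<theta> x)"
          by (simp add: indicator_def)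
        then show "ennreal (level_density (n + n0) \<theta> x) * indicator {..a} x \<le> ?w x"
          using level_density_le[of "n + n0" x] by (rule order_trans) simp
      qed
      show "AE x in lborel. (\<lambda>n. ennreal (level_density (n + n0) \<theta> x) * indicator {..a} x) \<longlonglongrightarrow> ennreal (g x) * indicator {..a} x"
        using LIMSEQ_ignore_initial_segment[OF lim, of n0]
        by (auto intro!: tendsto_ennrealI simp: indicator_def)
    qed (use w_fin in auto)
    then show ?thesis
      unfolding G_def by (subst emeasure_density) (auto intro: LIMSEQ_offset)
  qed
  have fin_\<nu>: "finite_borel_measure \<nu>"
    unfolding \<nu>_def by (intro finite_borel_measure.intro \<mu>.finite_measure_distr)
      (auto intro!: finite_borel_measure_axioms.intro)
  have fin_G: "finite_borel_measure G"
  proof (intro finite_borel_measure.intro finite_borel_measure_axioms.intro finite_measureI)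
    have "emeasure G (space G) = (\<integral>\<^sup>+x. ennreal (g x) \<partial>lborel)"
      unfolding G_def by (subst emeasure_density) auto
    also have "\<dots> \<le> (\<integral>\<^sup>+x. ?w x \<partial>lborel)"
    proof (rule nn_integral_mono)
      fix x
      show "ennreal (g x) \<le> ?w x"
        by (rule LIMSEQ_le_const2[OF tendsto_ennrealI[OF lim]]) (use level_density_le in blast)
    qed
    finally show "emeasure G (space G) \<noteq> \<infinity>" using w_fin by auto
  qed (simp add: G_def)
  interpret \<nu>: finite_borel_measure \<nu> by (rule fin_\<nu>)
  interpret G: finite_borel_measure G by (rule fin_G)
  have resample_error_small: "eventually (\<lambda>n. resample_error n < \<delta>) sequentially" if "0 < \<delta>" for \<delta>
  proof (rule order_tendstoD(2)[OF _ that])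
    show "resample_error \<longlonglongrightarrow> 0"
      unfolding resample_error_def using lmax lmax_pos by real_asymp
  qed
  have \<nu>_le: "cdf \<nu> a \<le> cdf G b" if "a < b" for a b
  proof -
    have "emeasure \<nu> {..a} \<le> emeasure G {..b}"
    proof (rule tendsto_lowerbound[OF F_lim])
      have "eventually (\<lambda>n. resample_error n < b - a) sequentially" using that by (intro resample_error_small) auto
      then show "eventually (\<lambda>n. emeasure \<nu> {..a} \<le> F n b) sequentially"
      proof eventually_elim
        case (elim n)
        have "emeasure \<nu> {..a} \<le> emeasure \<nu> {..b - resample_error n}"
          using elim by (intro emeasure_mono) (auto simp: \<nu>_def)
        also have "\<dots> \<le> F n b"
          unfolding \<nu>_def F_def by (rule level_density_cdf_sandwich[OF \<theta>])
        finally show ?case .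
      qed
    qed simp
    then show ?thesis by (simp add: cdf_def \<nu>.emeasure_eq_measure G.emeasure_eq_measure)
  qed
  have G_le: "cdf G a \<le> cdf \<nu> b" if "a < b" for a b
  proof -
    have "emeasure G {..a} \<le> emeasure \<nu> {..b}"
    proof (rule tendsto_upperbound[OF F_lim])
      have "eventually (\<lambda>n. resample_error n < b - a) sequentially" using that by (intro resample_error_small) auto
      then show "eventually (\<lambda>n. F n a \<le> emeasure \<nu> {..b}) sequentially"
      proof eventually_elim
        case (elim n)
        have "F n a \<le> emeasure \<nu> {..a + resample_error n}"
          unfolding \<nu>_def F_def by (rule level_density_cdf_sandwich[OF \<theta>])
        also have "\<dots> \<le> emeasure \<nu> {..b}"
          using elim by (intro emeasure_mono) (auto simp: \<nu>_def)
        finally show ?case .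
      qed
    qed simp
    then show ?thesis by (simp add: cdf_def \<nu>.emeasure_eq_measure G.emeasure_eq_measure)
  qed
  have "cdf \<nu> a = cdf G a" for a
  proof (rule antisym)
    have "(cdf G \<longlongrightarrow> cdf G a) (at_right a)"
      using G.cdf_is_right_cont[of a] by (simp add: continuous_within)
    then show "cdf \<nu> a \<le> cdf G a"
      by (rule tendsto_lowerbound) (auto simp: eventually_at_right_field intro!: \<nu>_le exI[of _ "a + 1"])
    have "(cdf \<nu> \<longlongrightarrow> cdf \<nu> a) (at_right a)"
      using \<nu>.cdf_is_right_cont[of a] by (simp add: continuous_within)
    then show "cdf G a \<le> cdf \<nu> a"
      by (rule tendsto_lowerbound) (auto simp: eventually_at_right_field intro!: G_le exI[of _ "a + 1"])
  qed
  then have "\<nu> = G" by (intro cdf_unique' fin_\<nu> fin_G) auto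
  then show ?thesis by (simp add: \<nu>_def G_def)
qed

lemma AE_holder_density:
  "AE \<theta> in perturbation_law N D. \<exists>g :: real \<Rightarrow> real. (\<forall>x. 0 \<le> g x) \<and> holder_continuous g \<and>
      distr \<mu> borel (random_projection lam t \<theta>) = density lborel (\<lambda>x. ennreal (g x))"
  using AE_holder_limit
proof eventually_elim
  case (elim \<theta>)
  then obtain g n0 U where g: "\<forall>x. (\<lambda>n. level_density n \<theta> x) \<longlonglongrightarrow> g x" "\<forall>x. 0 \<le> g x" "holder_continuous g"
    "\<forall>n\<ge>n0. \<forall>x. level_density n \<theta> x \<le> U" by (elim conjE exE)
  have "distr \<mu> borel (random_projection lam t \<theta>) = density lborel (\<lambda>x. ennreal (g x))"
  proof (rule distr_eq_density_limit)
    show "\<bar>\<theta> w\<bar> \<le> B" if "w \<in> lists {1..N}" for w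
      using elim that by simp
    show "(\<lambda>n. level_density n \<theta> x) \<longlonglongrightarrow> g x" for x
      using g(1) by (rule spec)
    show "level_density n \<theta> x \<le> U" if "n0 \<le> n" for n x
      using g(4) that by simp
  qed
  then show ?case using g by blast
qed

end

section \<open>Absolute continuity with Hoelder density\<close>

theorem theorem1p1:
  fixes N :: nat
    and lam t :: "nat \<Rightarrow> real"
    and s s' K C M :: real
    and \<mu> :: "(nat \<Rightarrow> nat) measure"
    and P :: "'a measure"
    and \<Theta> :: "'a \<Rightarrow> real"
  assumes ratios: "\<And>i. i \<in> {1..N} \<Longrightarrow> 0 < lam i \<and> lam i < 1"
    and similarity_dimension: "(\<Sum>i = 1..N. lam i powr s) = 1"
    and "s > 1"
    and borel_measure: "sets \<mu> = sets (seq_borel N)"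
    and "K > 0" and "s' > 1"
    and cylinder_bound:
      "\<And>w. w \<in> lists {1..N} \<Longrightarrow>
        emeasure \<mu> (cylinder N w) \<le> ennreal (K * word_ratio lam w powr s')"
    and "prob_space P"
    and random_variable: "\<Theta> \<in> borel_measurable P"
    and bounded: "\<exists>B. AE x in P. \<bar>\<Theta> x\<bar> \<le> B"
    and compact_support: "compact (measure_support (distr P borel \<Theta>))"
    and abs_cont: "absolutely_continuous lborel (distr P borel \<Theta>)"
    and "C > 0" and "M \<ge> s'"
    and fourier_decay: "\<And>x. norm (char (distr P borel \<Theta>) x) \<le> C / (1 + \<bar>x\<bar>) powr M"
  shows "AE \<theta> in perturbation_law N (distr P borel \<Theta>).
      absolutely_continuous lborel (distr \<mu> borel (random_projection lam t \<theta>)) \<and>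
      (\<exists>g :: real \<Rightarrow> real. (\<forall>x. 0 \<le> g x) \<and> holder_continuous g \<and>
         distr \<mu> borel (random_projection lam t \<theta>) = density lborel (\<lambda>x. ennreal (g x)))"
proof -
  define D where "D = distr P borel \<Theta>"
  have D: "real_distribution D"
    unfolding D_def using \<open>prob_space P\<close> random_variable by (rule prob_space.real_distribution_distr)
  interpret D: real_distribution D by (rule D)
  have atomless: "D.prob {a} = 0" for a
  proof -
    have "{a} \<in> null_sets D"
      using abs_cont unfolding D_def absolutely_continuous_def by (auto intro: finite_imp_null_set_lborel)
    then show ?thesis by (simp add: measure_def null_setsD1)
  qed
  have decay: "norm (char D x) \<le> C * (1 + \<bar>x\<bar>) powr (- M)" for x
    using fourier_decay[of x] by (simp add: D_def powr_minus divide_inverse)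
  have M: "1 < M" using \<open>s' > 1\<close> \<open>M \<ge> s'\<close> by simp
  obtain h H L \<gamma> where h: "\<And>x. 0 \<le> h x" "\<And>x. h x \<le> H" "0 < \<gamma>" "\<gamma> \<le> 1"
    "\<And>x y. \<bar>h x - h y\<bar> \<le> L * \<bar>x - y\<bar> powr \<gamma>"
    "D = density lborel (\<lambda>x. ennreal (h x))"
    by (rule D.holder_density_of_char_decay[OF atomless M decay]) (rule that, assumption+)
  have h_cont: "continuous_on UNIV h"
    by (rule continuous_on_of_holder_bound[OF h(3)]) (use h(5) in auto)
  obtain B0 where B0: "AE x in P. \<bar>\<Theta> x\<bar> \<le> B0" using bounded by blast
  define B where "B = max 0 B0"
  have B: "AE x in D. \<bar>x\<bar> \<le> B"
    unfolding D_def using random_variable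
    by (subst AE_distr_iff) (auto intro: eventually_mono[OF B0] simp: B_def le_max_iff_disj)
  have N: "1 \<le> N"
    using similarity_dimension by (cases "N = 0") auto
  define lmin where "lmin = Min (lam ` {1..N})"
  define lmax where "lmax = Max (lam ` {1..N})"
  define T where "T = Max ((\<lambda>i. \<bar>t i\<bar>) ` {1..N})"
  have ne: "lam ` {1..N} \<noteq> {}" using N by simp
  have "lmin \<in> lam ` {1..N}" "lmax \<in> lam ` {1..N}"
    unfolding lmin_def lmax_def by (intro Min_in Max_in ne; simp)+
  then have l: "0 < lmin" "lmax < 1" using ratios by auto
  interpret perturbed_ifs N lam t lmin lmax T K s' \<mu> D h H L \<gamma> B
  proof
    show "h x = 0" if "B < \<bar>x\<bar>" for x
      using density_eq_0_outside[OF h_cont h(1)] B that unfolding h(6) by blast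
    show "lmin \<le> lam i" "lam i \<le> lmax" "\<bar>t i\<bar> \<le> T" if "i \<in> {1..N}" for i
      using that by (auto simp: lmin_def lmax_def T_def)
    show "0 \<le> B" by (simp add: B_def)
  qed (fact l N borel_measure \<open>K > 0\<close> \<open>s' > 1\<close> cylinder_bound D h B)+
  show ?thesis
    using AE_holder_density unfolding D_def[symmetric]
  proof eventually_elim
    case (elim \<theta>)
    then obtain g :: "real \<Rightarrow> real" where g: "\<forall>x. 0 \<le> g x" "holder_continuous g"
      "distr \<mu> borel (random_projection lam t \<theta>) = density lborel (\<lambda>x. ennreal (g x))" by blast
    have "g \<in> borel_measurable borel"
      by (rule borel_measurable_holder_continuous) fact
    then have "absolutely_continuous lborel (distr \<mu> borel (random_projection lam t \<theta>))"
      unfolding g(3) by (intro absolutely_continuousI_density) auto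
    then show ?case using g by blast
  qed
qed

end
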